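(* $\kappa[a,b,c]=-\infty$ for positive real parameters $a,b$ and $c$ with $a+b-1<c<a+b+\tfrac12$ and $(c-a)(c-b)>0$. In particular, the function ${}_2F_1(a+1,b;c;z)/{}_2F_1(a,b;c;z)$ is not convex on $\mathbb{D}$ in this case.
   Context: $\mathbb{D}=\{z\in\mathbb{C}:|z|<1\}$, and $\mathrm{Hol}(\mathbb{D})$ is the set of all holomorphic functions on $\mathbb{D}$. The Gaussian hypergeometric function is defined for $z\in\mathbb{D}$ by ${}_2F_1(a,b;c;z)=\sum_{n=0}^{\infty}\frac{(a)_n(b)_n}{(c)_n\,n!}z^n$, where $(a)_0=1$, $(a)_n=a(a+1)\cdots(a+n-1)$ for $n\ge1$, and $a,b,c$ are complex numbers with $c\notin\{0,-1,-2,\dots\}$. Put $w_{a,b,c}(z)=\dfrac{{}_2F_1(a+1,b;c;z)}{{}_2F_1(a,b;c;z)}$. For a non-constant function $f\in\mathrm{Hol}(\mathbb{D})$, the order of convexity is $\kappa(f)=1+\inf_{z\in\mathbb{D}}\operatorname{Re}\frac{zf''(z)}{f'(z)}\in[-\infty,1]$. The function $f$ is called convex if $\kappa(f)\ge0$; it is known that this holds if and only if $f$ is univalent in $\mathbb{D}$ and $f(\mathbb{D})$ is a convex domain. Write $\kappa[a,b,c]=\kappa(w_{a,b,c})$. *)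

theory Defs
  imports "HOL-Complex_Analysis.Complex_Analysis"
begin

text \<open>The unit disc \<open>\<bbbD>\<close> is \<^term>\<open>ball 0 1 :: complex set\<close>.\<close>

definition hyp2F1 :: "complex \<Rightarrow> complex \<Rightarrow> complex \<Rightarrow> complex \<Rightarrow> complex" where
  "hyp2F1 a b c z =
     (\<Sum>n. pochhammer a n * pochhammer b n / (pochhammer c n * fact n) * z ^ n)"

definition hyp_ratio :: "complex \<Rightarrow> complex \<Rightarrow> complex \<Rightarrow> complex \<Rightarrow> complex" where
  "hyp_ratio a b c z = hyp2F1 (a + 1) b c z / hyp2F1 a b c z"

text \<open>The infimum is taken in the extended reals, so that the value \<open>-\<infinity>\<close> is possible. Since
  division by zero yields \<open>0\<close>, a zero of \<open>f'\<close> contributes \<open>0\<close> to the infimum. At a zero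
  \<open>z \<noteq> 0\<close> this is harmless, because for non-constant holomorphic \<open>f\<close> the real part is unbounded below
  in every punctured neighbourhood of \<open>z\<close>, hence the infimum is \<open>-\<infinity>\<close> there anyway; at
  \<open>z = 0\<close> it only matters for \<open>f' 0 = 0\<close> and never affects whether the infimum is \<open>-\<infinity>\<close>.\<close>

definition order_of_convexity :: "(complex \<Rightarrow> complex) \<Rightarrow> ereal" where
  "order_of_convexity f =
     1 + (INF z \<in> ball 0 1. ereal (Re (z * deriv (deriv f) z / deriv f z)))"

text \<open>Holomorphy and non-constancy of \<open>f\<close> on the disc are the caller's concern and are deliberately not
  conjuncts here, so that the negation says something about the order of convexity.\<close>

definition convex_on_disc :: "(complex \<Rightarrow> complex) \<Rightarrow> bool" where
  "convex_on_disc f \<longleftrightarrow> order_of_convexity f \<ge> 0"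

definition kappa :: "complex \<Rightarrow> complex \<Rightarrow> complex \<Rightarrow> ereal" where
  "kappa a b c = order_of_convexity (hyp_ratio a b c)"

end

theory Submission
  imports Defs "HOL-Real_Asymp.Real_Asymp"
begin

text \<open>Write \<open>F = hyp2F1 a b c\<close> and \<open>\<delta> = c - a - b\<close>. The function \<open>Y z = (1 - z) F' z / F z\<close> satisfies a Riccati
  equation, so \<open>w = hyp_ratio a b c = 1 + z Y / (a (1 - z))\<close> has \<open>h z = z w'' / w'\<close> rational in \<open>z\<close> and \<open>Y\<close>.
  The identity \<open>Y + \<delta> = (c - a) (c - b) / c * hyp2F1 a b (c + 1) / F\<close> and a comparison of Taylor coefficients with
  binomial series give the behaviour of \<open>Y\<close> as \<open>x \<rightarrow> 1\<close> along the real axis: \<open>(1 - x) h x\<close> has a limit \<open>L\<close>, but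
  \<open>h x - L / (1 - x)\<close> tends to \<open>-\<infinity>\<close>; for \<open>\<delta> \<ge> 0\<close> the sign comes from \<open>1 - 2 * \<delta> > 0\<close>. If \<open>Re h\<close> were bounded
  below on the disc, Harnack's inequality would make \<open>(1 - x) / (1 + x) * (h x + M)\<close> decreasing for some \<open>M\<close>, hence at least
  \<open>L / 2\<close>, so \<open>h x - L / (1 - x)\<close> would be bounded below.\<close>

subsection \<open>Growth of hypergeometric series with positive parameters\<close>

text \<open>\<open>Gamma_series'\<close> converges to \<open>Gamma\<close>, so the quotient
  \<open>G\<close> is bounded. For \<open>n \<ge> 1\<close> it equals \<open>P n\<close> times
  \<open>n\<close> to the power \<open>c + d - a - b\<close>; this exponent is nonnegative, hence
  \<open>P n \<le> G n\<close>.\<close>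

lemma pochhammer_prod_bound:
  fixes a b c d :: real
  assumes pos: "a > 0" "b > 0" "c > 0" "d > 0" and le: "a + b \<le> c + d"
  obtains C where "C > 0"
    "\<And>n. pochhammer a n * pochhammer b n \<le> C * (pochhammer c n * pochhammer d n)"
proof -
  define P where "P n = pochhammer a n * pochhammer b n / (pochhammer c n * pochhammer d n)" for n
  define G where "G n = Gamma_series' c n * Gamma_series' d n / (Gamma_series' a n * Gamma_series' b n)" for n
  have "G \<longlonglongrightarrow> Gamma c * Gamma d / (Gamma a * Gamma b)"
    unfolding G_def using pos less_imp_neq[OF Gamma_real_pos[of a]] less_imp_neq[OF Gamma_real_pos[of b]]
    by (intro tendsto_intros Gamma_series'_LIMSEQ) (auto dest: less_imp_neq[symmetric])
  then obtain K where K: "K > 0" "\<And>n. norm (G n) \<le> K"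
    using convergentI convergent_imp_Bseq BseqE by metis
  have PG: "P n \<le> K" if "n \<ge> 1" for n
  proof -
    define e where "e x = exp (x * ln (real n))" for x
    have e: "e a * e b \<le> e c * e d" "e x > 0" for x
      unfolding e_def using le that
      by (auto simp: mult_exp_exp ring_distribs[symmetric] intro!: mult_right_mono)
    have p: "pochhammer x n > 0" if "x > 0" for x :: real
      using that by (rule pochhammer_pos)
    have "G n = P n * ((e c * e d) / (e a * e b))"
      unfolding G_def P_def Gamma_series'_def e_def using pos[THEN p]
      by (simp add: field_simps)
    moreover have "P n \<ge> 0"
      unfolding P_def using pos[THEN p] by simp
    moreover have "(e c * e d) / (e a * e b) \<ge> 1"
      using e by simp
    ultimately have "P n \<le> G n"
      by (metis mult.right_neutral mult_left_mono)
    with K(2)[of n] show ?thesis by simp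
  qed
  have P: "P n \<le> max K 1" for n
    using PG[of n] by (cases "n = 0") (auto simp: P_def)
  have "pochhammer a n * pochhammer b n \<le> max K 1 * (pochhammer c n * pochhammer d n)" for n
    using P[of n] pos pochhammer_pos[of c n] pochhammer_pos[of d n]
    unfolding P_def by (simp add: pos_divide_le_eq del: le_max_iff_disj)
  thus ?thesis using that[of "max K 1"] by simp
qed

text \<open>Polymorphic, so that identities proved over the reals transfer to the complex series by
  \<open>hyp_coeff_of_real\<close>.\<close>

definition hyp_coeff :: "'a :: real_normed_field \<Rightarrow> 'a \<Rightarrow> 'a \<Rightarrow> nat \<Rightarrow> 'a" where
  "hyp_coeff a b c n = pochhammer a n * pochhammer b n / (pochhammer c n * fact n)"

definition hyp2F1_real :: "real \<Rightarrow> real \<Rightarrow> real \<Rightarrow> real \<Rightarrow> real" where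
  "hyp2F1_real a b c x = (\<Sum>n. hyp_coeff a b c n * x ^ n)"

lemma hyp_coeff_of_real:
  "hyp_coeff (of_real a) (of_real b) (of_real c) n = of_real (hyp_coeff a b c n)"
  by (simp add: hyp_coeff_def pochhammer_of_real[symmetric])

text \<open>Supplies the comparison functions: a coefficient bound against
  \<open>pochhammer d n / fact n\<close> becomes a bound of the sum against
  \<open>(1 - x) powr (-d)\<close>. It is the generalised binomial series at \<open>-x\<close> with
  exponent \<open>-d\<close>, where the signs cancel.\<close>

lemma binomial_series_sums:
  fixes d x :: real
  assumes "\<bar>x\<bar> < 1"
  shows "(\<lambda>n. pochhammer d n / fact n * x ^ n) sums (1 - x) powr (-d)"
proof -
  have "((-d) gchoose n) * (-x) ^ n = pochhammer d n / fact n * x ^ n" for n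
  proof -
    have "(-1) ^ n * (-x) ^ n = x ^ n" by (simp flip: power_mult_distrib)
    thus ?thesis by (simp add: gbinomial_pochhammer mult.commute mult.left_commute)
  qed
  with gen_binomial_real[of "-x" "-d"] assms show ?thesis by simp
qed

section \<open>Positive coefficients, convergence and growth near 1\<close>

context
  fixes a b c :: real
  assumes a: "a > 0" and b: "b > 0" and c: "c > 0"
begin

lemma hyp_coeff_pos: "hyp_coeff a b c n > 0"
  using a b c by (simp add: hyp_coeff_def pochhammer_pos)

text \<open>This is \<open>pochhammer_prod_bound\<close> divided by
  \<open>pochhammer c n * fact n\<close>. Together with the lower bound below,
  \<open>d = a + b - c\<close> gives the exact order of growth whenever this number is
  positive.\<close>

lemma hyp_coeff_le:
  assumes "d > 0" "a + b \<le> c + d"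
  obtains C where "C > 0" "\<And>n. hyp_coeff a b c n \<le> C * (pochhammer d n / fact n)"
proof -
  obtain C where C: "C > 0"
    "\<And>n. pochhammer a n * pochhammer b n \<le> C * (pochhammer c n * pochhammer d n)"
    using pochhammer_prod_bound a b c assms by metis
  have "hyp_coeff a b c n \<le> C * (pochhammer d n / fact n)" for n
    using C(2)[of n] pochhammer_pos[OF c, of n] by (simp add: hyp_coeff_def field_simps)
  with C(1) show ?thesis using that by blast
qed

lemma hyp_coeff_ge:
  assumes "d > 0" "a + b \<ge> c + d"
  obtains C where "C > 0" "\<And>n. hyp_coeff a b c n \<ge> C * (pochhammer d n / fact n)"
proof -
  obtain C where C: "C > 0"
    "\<And>n. pochhammer c n * pochhammer d n \<le> C * (pochhammer a n * pochhammer b n)"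
    using pochhammer_prod_bound a b c assms by metis
  have "hyp_coeff a b c n \<ge> (1 / C) * (pochhammer d n / fact n)" for n
    using C(2)[of n] C(1) pochhammer_pos[OF c, of n] by (simp add: hyp_coeff_def field_simps)
  with C(1) show ?thesis using that[of "1 / C"] by simp
qed

lemma summable_hyp2F1_real_nonneg:
  fixes x :: real
  assumes "0 \<le> x" "x < 1"
  shows "summable (\<lambda>n. hyp_coeff a b c n * x ^ n)"
proof -
  \<comment> \<open>\<open>d = a + b\<close> meets both conditions of \<open>hyp_coeff_le\<close>,
    since \<open>c > 0\<close>.\<close>
  obtain C where C: "C > 0" "\<And>n. hyp_coeff a b c n \<le> C * (pochhammer (a + b) n / fact n)"
    using hyp_coeff_le[of "a + b"] a b c by auto
  have "summable (\<lambda>n. C * (pochhammer (a + b) n / fact n * x ^ n))"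
    using binomial_series_sums[of x] assms by (intro summable_mult sums_summable) auto
  moreover have "norm (hyp_coeff a b c n * x ^ n) \<le> C * (pochhammer (a + b) n / fact n * x ^ n)" for n
    using mult_right_mono[OF C(2)[of n], of "x ^ n"] hyp_coeff_pos[of n] assms
    by (simp add: abs_mult mult.assoc)
  ultimately show ?thesis
    by (rule summable_comparison_test'[of _ 0])
qed

lemma summable_hyp2F1:
  fixes z :: complex
  assumes "norm z < 1"
  shows "summable (\<lambda>n. hyp_coeff (of_real a) (of_real b) (of_real c) n * z ^ n)"
proof -
  obtain r where r: "norm z < r" "r < 1" using dense assms by blast
  hence "summable (\<lambda>n. complex_of_real (hyp_coeff a b c n * r ^ n))"
    using summable_hyp2F1_real_nonneg[of r] norm_ge_zero[of z] by (intro summable_of_real) linarith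
  hence "summable (\<lambda>n. complex_of_real (hyp_coeff a b c n) * of_real r ^ n)"
    by simp
  from powser_inside[OF this, of z] r norm_ge_zero[of z] show ?thesis
    unfolding hyp_coeff_of_real by simp
qed

lemma summable_hyp2F1_real:
  fixes x :: real
  assumes "\<bar>x\<bar> < 1"
  shows "summable (\<lambda>n. hyp_coeff a b c n * x ^ n)"
proof -
  obtain r where r: "\<bar>x\<bar> < r" "r < 1" using dense assms by blast
  hence "summable (\<lambda>n. hyp_coeff a b c n * r ^ n)"
    using summable_hyp2F1_real_nonneg[of r] by linarith
  thus ?thesis
    by (rule powser_inside) (use r in auto)
qed

lemma hyp2F1_sums:
  assumes "norm z < 1"
  shows "(\<lambda>n. hyp_coeff (of_real a) (of_real b) (of_real c) n * z ^ n)
           sums hyp2F1 (of_real a) (of_real b) (of_real c) z"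
  using summable_sums[OF summable_hyp2F1[OF assms]] by (simp add: hyp2F1_def hyp_coeff_def)

lemma hyp2F1_of_real:
  assumes "\<bar>x\<bar> < 1"
  shows "hyp2F1 (of_real a) (of_real b) (of_real c) (of_real x) = of_real (hyp2F1_real a b c x)"
proof -
  have "(\<lambda>n. complex_of_real (hyp_coeff a b c n * x ^ n)) sums of_real (hyp2F1_real a b c x)"
    unfolding hyp2F1_real_def by (intro sums_of_real summable_sums summable_hyp2F1_real assms)
  moreover have "(\<lambda>n. complex_of_real (hyp_coeff a b c n * x ^ n))
      sums hyp2F1 (of_real a) (of_real b) (of_real c) (of_real x)"
    using hyp2F1_sums[of "of_real x"] assms by (simp add: hyp_coeff_of_real)
  ultimately show ?thesis
    by (rule sums_unique2[symmetric])
qed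

lemma hyp2F1_real_le:
  assumes "d > 0" "a + b \<le> c + d"
  obtains C where "C > 0"
    "\<And>x. 0 \<le> x \<Longrightarrow> x < 1 \<Longrightarrow> hyp2F1_real a b c x \<le> C * (1 - x) powr (-d)"
proof -
  obtain C where C: "C > 0" "\<And>n. hyp_coeff a b c n \<le> C * (pochhammer d n / fact n)"
    using hyp_coeff_le assms by blast
  have "hyp2F1_real a b c x \<le> C * (1 - x) powr (-d)" if "0 \<le> x" "x < 1" for x
    unfolding hyp2F1_real_def
    by (rule sums_le[OF _ summable_sums[OF summable_hyp2F1_real] sums_mult[OF binomial_series_sums]])
       (use that mult_right_mono[OF C(2), of "x ^ n" for n] in \<open>auto simp: mult.assoc\<close>)
  with C(1) show ?thesis using that by blast
qed

lemma hyp2F1_real_ge: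
  assumes "d > 0" "a + b \<ge> c + d"
  obtains C where "C > 0"
    "\<And>x. 0 \<le> x \<Longrightarrow> x < 1 \<Longrightarrow> hyp2F1_real a b c x \<ge> C * (1 - x) powr (-d)"
proof -
  obtain C where C: "C > 0" "\<And>n. hyp_coeff a b c n \<ge> C * (pochhammer d n / fact n)"
    using hyp_coeff_ge assms by blast
  have "hyp2F1_real a b c x \<ge> C * (1 - x) powr (-d)" if "0 \<le> x" "x < 1" for x
    unfolding hyp2F1_real_def
    by (rule sums_le[OF _ sums_mult[OF binomial_series_sums] summable_sums[OF summable_hyp2F1_real]])
       (use that mult_right_mono[OF C(2), of "x ^ n" for n] in \<open>auto simp: mult.assoc\<close>)
  with C(1) show ?thesis using that by blast
qed

text \<open>The constant term is 1 and the other terms are nonnegative. In particular the function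
  may be divided by on \<open>[0, 1)\<close>.\<close>

lemma hyp2F1_real_ge_1:
  assumes "0 \<le> x" "x < 1"
  shows "hyp2F1_real a b c x \<ge> 1"
proof -
  have "(\<Sum>n<1. hyp_coeff a b c n * x ^ n) \<le> hyp2F1_real a b c x"
    unfolding hyp2F1_real_def
    by (intro sum_le_suminf summable_hyp2F1_real) (use assms hyp_coeff_pos[THEN less_imp_le] in auto)
  thus ?thesis by (simp add: hyp_coeff_def)
qed

text \<open>\<open>diffs\<close> yields the coefficients of the termwise derivative. The general
  codomain serves the real and the complex series at once.\<close>

lemma diffs_hyp_coeff:
  "diffs (hyp_coeff (of_real a) (of_real b) (of_real c) :: nat \<Rightarrow> 'a :: real_normed_field) n =
    of_real (a * b / c) * hyp_coeff (of_real (a + 1)) (of_real (b + 1)) (of_real (c + 1)) n"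
proof -
  have "diffs (hyp_coeff a b c) n = a * b / c * hyp_coeff (a + 1) (b + 1) (c + 1) n"
    unfolding diffs_def hyp_coeff_def pochhammer_rec fact_Suc
    using c pochhammer_pos[of "c + 1" n] by (simp add: field_simps del: of_nat_Suc)
  moreover have "diffs (hyp_coeff (of_real a) (of_real b) (of_real c) :: nat \<Rightarrow> 'a) n
      = of_real (diffs (hyp_coeff a b c) n)"
    by (simp only: diffs_def hyp_coeff_of_real of_real_mult of_real_of_nat_eq)
  ultimately show ?thesis
    by (simp only: hyp_coeff_of_real of_real_mult)
qed

text \<open>The factor \<open>Suc n\<close> stays on the left to match the shape of
  \<open>diffs\<close>.\<close>

lemma hyp_coeff_Suc:
  "of_nat (Suc n) * hyp_coeff (complex_of_real a) (complex_of_real b) (complex_of_real c) (Suc n) = hyp_coeff (complex_of_real a) (complex_of_real b) (complex_of_real c) n * ((of_real a + of_nat n) * (of_real b + of_nat n) / (of_real c + of_nat n))"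
proof -
  have "real (Suc n) * hyp_coeff a b c (Suc n) = hyp_coeff a b c n * ((a + n) * (b + n) / (c + n))"
    using c pochhammer_pos[OF c, of n] unfolding hyp_coeff_def fact_Suc pochhammer_Suc
    by (simp add: divide_simps mult_ac del: of_nat_Suc)
  hence "complex_of_real (real (Suc n) * hyp_coeff a b c (Suc n)) = of_real (hyp_coeff a b c n * ((a + n) * (b + n) / (c + n)))"
    by simp
  thus ?thesis unfolding hyp_coeff_of_real by simp
qed

lemma hyp_coeff_c_plus_1:
  "hyp_coeff (of_real a) (of_real b) (of_real (c + 1)) n = hyp_coeff (complex_of_real a) (complex_of_real b) (complex_of_real c) n * (of_real c / (of_real c + of_nat n))"
proof -
  have "c * pochhammer (c + 1) n = pochhammer c n * (c + n)"
    by (metis pochhammer_rec pochhammer_Suc)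
  moreover have "pochhammer c n > 0" "pochhammer (c + 1) n > 0" "c + n > 0"
    using c by (auto intro: pochhammer_pos)
  ultimately have "hyp_coeff a b (c + 1) n = hyp_coeff a b c n * (c / (c + n))"
    using c by (simp add: hyp_coeff_def divide_simps mult_ac)
  thus ?thesis unfolding hyp_coeff_of_real by simp
qed

lemma hyp_coeff_a_plus_1:
  "of_real a * hyp_coeff (of_real (a + 1)) (of_real b) (of_real c) n = (of_real a + of_nat n) * hyp_coeff (complex_of_real a) (complex_of_real b) (complex_of_real c) n"
proof -
  have "a * pochhammer (a + 1) n = pochhammer a n * (a + n)"
    by (metis pochhammer_rec pochhammer_Suc)
  hence "a * hyp_coeff (a + 1) b c n = (a + n) * hyp_coeff a b c n"
    unfolding hyp_coeff_def by (metis mult.assoc mult.commute times_divide_eq_right)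
  hence "complex_of_real (a * hyp_coeff (a + 1) b c n) = of_real ((a + n) * hyp_coeff a b c n)"
    by simp
  thus ?thesis unfolding hyp_coeff_of_real by simp
qed

end

text \<open>The derivative in \<open>z\<close> in closed form;
  \<open>hyp2F1_has_field_derivative\<close> justifies the name.\<close>

definition hyp2F1' :: "complex \<Rightarrow> complex \<Rightarrow> complex \<Rightarrow> complex \<Rightarrow> complex" where
  "hyp2F1' a b c z = a * b / c * hyp2F1 (a + 1) (b + 1) (c + 1) z"

section \<open>Derivatives and contiguous relations\<close>

context
  fixes a b c :: real and z :: complex
  assumes a: "a > 0" and b: "b > 0" and c: "c > 0" and z: "norm z < 1"
begin

private abbreviation (input) "f \<equiv> hyp_coeff (complex_of_real a) (complex_of_real b) (complex_of_real c)"
private abbreviation (input) "F \<equiv> hyp2F1 (complex_of_real a) (complex_of_real b) (complex_of_real c)"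
private abbreviation (input) "F' \<equiv> hyp2F1' (complex_of_real a) (complex_of_real b) (complex_of_real c)"

lemma hyp2F1'_sums: "(\<lambda>n. diffs f n * z ^ n) sums F' z"
proof -
  have "(\<lambda>n. of_real (a * b / c) * (hyp_coeff (of_real (a + 1)) (of_real (b + 1)) (of_real (c + 1)) n * z ^ n)) sums
      (of_real (a * b / c) * hyp2F1 (of_real (a + 1)) (of_real (b + 1)) (of_real (c + 1)) z)"
    by (intro sums_mult hyp2F1_sums) (use a b c z in auto)
  thus ?thesis
    using a b c by (simp add: diffs_hyp_coeff hyp2F1'_def mult.assoc)
qed

lemma hyp2F1_has_field_derivative: "(F has_field_derivative F' z) (at z)"
proof -
  have "((\<lambda>z. \<Sum>n. f n * z ^ n) has_field_derivative (\<Sum>n. diffs f n * z ^ n)) (at z)"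
    by (rule termdiffs_strong'[of 1]) (use summable_hyp2F1[OF a b c] z in auto)
  moreover have "(\<lambda>z. \<Sum>n. f n * z ^ n) = F"
    by (simp add: hyp2F1_def hyp_coeff_def fun_eq_iff)
  ultimately show ?thesis
    using sums_unique[OF hyp2F1'_sums] by simp
qed

text \<open>The operator \<open>z d/dz\<close> multiplies the \<open>n\<close>-th coefficient by
  \<open>n\<close>; the term added at index 0 vanishes.\<close>

lemma hyp2F1'_sums_shift: "(\<lambda>n. of_nat n * f n * z ^ n) sums (z * F' z)"
proof -
  have "(\<lambda>n. of_nat (Suc n) * f (Suc n) * z ^ Suc n) sums (z * F' z)"
    using sums_mult[OF hyp2F1'_sums, of z] by (simp add: diffs_def mult_ac)
  thus ?thesis
    by (subst (asm) sums_Suc_iff) simp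
qed

text \<open>The operator \<open>a + z d/dz\<close> multiplies the \<open>n\<close>-th coefficient by
  \<open>a + n\<close>, which up to the factor \<open>a\<close> raises the first parameter.\<close>

lemma hyp2F1_a_plus_1: "of_real a * hyp2F1 (of_real a + 1) (of_real b) (of_real c) z = of_real a * F z + z * F' z"
proof -
  have "(\<lambda>n. of_real a * (hyp_coeff (of_real (a + 1)) (of_real b) (of_real c) n * z ^ n)) sums
      (of_real a * hyp2F1 (of_real (a + 1)) (of_real b) (of_real c) z)"
    by (intro sums_mult hyp2F1_sums) (use a b c z in auto)
  moreover have "(\<lambda>n. of_real a * (f n * z ^ n) + of_nat n * f n * z ^ n) sums (of_real a * F z + z * F' z)"
    by (intro sums_add sums_mult hyp2F1_sums hyp2F1'_sums_shift a b c z)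
  moreover have "of_real a * (hyp_coeff (of_real (a + 1)) (of_real b) (of_real c) n * z ^ n) =
      of_real a * (f n * z ^ n) + of_nat n * f n * z ^ n" for n
    using hyp_coeff_a_plus_1[OF a b c, of n] by (simp add: ring_distribs flip: mult.assoc)
  ultimately show ?thesis
    using sums_unique2 by fastforce
qed

text \<open>On the left the \<open>n\<close>-th coefficient is \<open>f n\<close> times
  \<open>(a + n) * (b + n) / (c + n) - n + (c - a - b)\<close>, and this factor collapses to
  \<open>(c - a) * (c - b) / (c + n)\<close>. The denominator \<open>c + n\<close> is what raising
  \<open>c\<close> produces.\<close>

lemma hyp2F1'_c_plus_1:
  "(1 - z) * F' z + of_real (c - a - b) * F z =
     of_real ((c - a) * (c - b) / c) * hyp2F1 (of_real a) (of_real b) (of_real c + 1) z"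
proof -
  have "(\<lambda>n. (diffs f n * z ^ n - of_nat n * f n * z ^ n) + of_real (c - a - b) * (f n * z ^ n)) sums
      ((F' z - z * F' z) + of_real (c - a - b) * F z)"
    by (intro sums_add sums_diff sums_mult hyp2F1_sums hyp2F1'_sums hyp2F1'_sums_shift a b c z)
  moreover have "(\<lambda>n. of_real ((c - a) * (c - b) / c) *
      (hyp_coeff (of_real a) (of_real b) (of_real (c + 1)) n * z ^ n)) sums
      (of_real ((c - a) * (c - b) / c) * hyp2F1 (of_real a) (of_real b) (of_real (c + 1)) z)"
    by (intro sums_mult hyp2F1_sums) (use a b c z in auto)
  moreover have "(diffs f n * z ^ n - of_nat n * f n * z ^ n) + of_real (c - a - b) * (f n * z ^ n) =
      of_real ((c - a) * (c - b) / c) *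
      (hyp_coeff (of_real a) (of_real b) (of_real (c + 1)) n * z ^ n)" for n
  proof -
    \<comment> \<open>Here \<open>y\<close> stands for \<open>f n\<close> and \<open>w\<close> for
      \<open>z ^ n\<close>: the claim reduces to an identity between the rational factors
      alone.\<close>
    have gen: "y * x * w - m * y * w + d * (y * w) = k * (y * v * w)" if "x - m + d = k * v"
      for x m d k v y w :: complex
      using that by algebra
    have "(a + n) * (b + n) / (c + n) - n + (c - a - b) = (c - a) * (c - b) / c * (c / (c + n))"
      using c by (simp add: divide_simps add_nonneg_eq_0_iff) (simp add: algebra_simps)
    hence "complex_of_real ((a + n) * (b + n) / (c + n) - n + (c - a - b)) = of_real ((c - a) * (c - b) / c * (c / (c + n)))"
      by (rule arg_cong)
    hence "(of_real a + of_nat n) * (of_real b + of_nat n) / (of_real c + of_nat n) - of_nat n + of_real (c - a - b)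
        = of_real ((c - a) * (c - b) / c) * (of_real c / (of_real c + of_nat n) :: complex)"
      by simp
    thus ?thesis
      unfolding hyp_coeff_c_plus_1[OF a b c] diffs_def hyp_coeff_Suc[OF a b c]
      by (rule gen)
  qed
  ultimately have "F' z - z * F' z + of_real (c - a - b) * F z =
      of_real ((c - a) * (c - b) / c) * hyp2F1 (of_real a) (of_real b) (of_real (c + 1)) z"
    by (metis (no_types, lifting) sums_cong sums_unique2)
  thus ?thesis by (simp add: algebra_simps)
qed

end

text \<open>The operator \<open>c + z d/dz\<close> multiplies the \<open>n\<close>-th coefficient by
  \<open>c + n\<close> and so cancels the factor \<open>c / (c + n)\<close> that raising
  \<open>c\<close> introduced.\<close>

lemma hyp2F1_c_plus_1:
  fixes a b c :: real
  assumes pos: "a > 0" "b > 0" "c > 0" and z: "norm z < 1"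
  shows "z * hyp2F1' (of_real a) (of_real b) (of_real c + 1) z + of_real c * hyp2F1 (of_real a) (of_real b) (of_real c + 1) z
     = of_real c * hyp2F1 (of_real a) (of_real b) (of_real c) z"
proof -
  let ?f = "hyp_coeff (of_real a) (of_real b) (of_real (c + 1)) :: nat \<Rightarrow> complex"
  have "(\<lambda>n. of_nat n * ?f n * z ^ n + of_real c * (?f n * z ^ n)) sums
     (z * hyp2F1' (of_real a) (of_real b) (of_real (c + 1)) z + of_real c * hyp2F1 (of_real a) (of_real b) (of_real (c + 1)) z)"
    by (intro sums_add sums_mult hyp2F1_sums hyp2F1'_sums_shift) (use pos z in auto)
  moreover have "of_nat n * ?f n * z ^ n + of_real c * (?f n * z ^ n) =
      of_real c * (hyp_coeff (of_real a) (of_real b) (of_real c) n * z ^ n)" for n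
  proof -
    have "of_real c + of_nat n = (of_real (c + n) :: complex)" by simp
    also have "\<dots> \<noteq> 0" using pos by (simp del: of_real_add)
    finally have "of_nat n * ?f n + of_real c * ?f n = of_real c * hyp_coeff (of_real a) (of_real b) (of_real c) n"
      using hyp_coeff_c_plus_1[OF pos, of n] by (simp add: divide_simps) (simp add: algebra_simps)
    moreover have "m * y * w + k * (y * w) = k * (v * w)" if "m * y + k * y = k * v"
      for m y w k v :: complex
      using that by algebra
    ultimately show ?thesis by blast
  qed
  moreover have "(\<lambda>n. of_real c * (hyp_coeff (of_real a) (of_real b) (of_real c) n * z ^ n)) sums
      (of_real c * hyp2F1 (of_real a) (of_real b) (of_real c) z)"
    by (intro sums_mult hyp2F1_sums pos z)
  ultimately have "z * hyp2F1' (of_real a) (of_real b) (of_real (c + 1)) z + of_real c * hyp2F1 (of_real a) (of_real b) (of_real (c + 1)) z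
      = of_real c * hyp2F1 (of_real a) (of_real b) (of_real c) z"
    by (metis (no_types, lifting) sums_cong sums_unique2)
  thus ?thesis by simp
qed

lemma hyp2F1_holomorphic:
  fixes a b c :: real
  assumes "a > 0" "b > 0" "c > 0"
  shows "hyp2F1 (of_real a) (of_real b) (of_real c) holomorphic_on ball 0 1"
  using hyp2F1_has_field_derivative[OF assms]
  by (intro holomorphic_onI) (auto simp: field_differentiable_def dest: has_field_derivative_at_within)

subsection \<open>Harnack's inequality\<close>

text \<open>Boundedness excludes poles, so every singularity is removable; the bound passes to the
  limits that \<open>remove_sings\<close> takes as values.\<close>

lemma meromorphic_bounded_remove_sings:
  assumes mero: "f meromorphic_on S" and S: "open S" and bd: "\<And>z. z \<in> S \<Longrightarrow> norm (f z) \<le> B"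
  shows "remove_sings f holomorphic_on S" and "\<And>z. z \<in> S \<Longrightarrow> norm (remove_sings f z) \<le> B"
proof -
  have lim: "\<exists>l. f \<midarrow>z\<rightarrow> l" and iso: "isolated_singularity_at f z"
    and ev: "eventually (\<lambda>w. norm (f w) \<le> B) (at z)" if z: "z \<in> S" for z
  proof -
    have f: "f meromorphic_on {z}" using mero z by (auto intro: meromorphic_on_subset)
    show "isolated_singularity_at f z" using f by (rule meromorphic_on_isolated_singularity)
    have "eventually (\<lambda>w. w \<in> S) (at z)" using S z by (rule eventually_at_in_open')
    thus ev: "eventually (\<lambda>w. norm (f w) \<le> B) (at z)" by eventually_elim (rule bd)
    have "\<not> is_pole f z"
    proof
      assume "is_pole f z"
      \<comment> \<open>The radius \<open>max 0 B + 1\<close> is positive and exceeds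
        \<open>B\<close>, whatever the sign of \<open>B\<close>.\<close>
      hence "eventually (\<lambda>w. norm (f w) \<ge> max 0 B + 1) (at z)"
        unfolding is_pole_def by (subst (asm) filterlim_at_infinity[of 0]) auto
      with ev have "eventually (\<lambda>w. False) (at z)" by eventually_elim auto
      thus False by simp
    qed
    with meromorphic_on_not_essential[OF f] show "\<exists>l. f \<midarrow>z\<rightarrow> l"
      by (auto simp: not_essential_def)
  qed
  have "remove_sings f analytic_on S"
    by (subst analytic_on_analytic_at) (use lim iso remove_sings_analytic_at in blast)
  thus "remove_sings f holomorphic_on S" by (rule analytic_imp_holomorphic)
  fix z assume z: "z \<in> S"
  obtain l where l: "f \<midarrow>z\<rightarrow> l" using lim z by blast
  have "norm l \<le> B"
    by (rule tendsto_upperbound[OF tendsto_norm[OF l] ev[OF z]]) simp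
  thus "norm (remove_sings f z) \<le> B" using remove_sings_eqI[OF l] by simp
qed

text \<open>For \<open>0 < t < 1\<close> the function \<open>t * f\<close> satisfies the strict
  bound of the usual Schwarz lemma; then \<open>t\<close> tends to 1. The weak bound is the one that
  survives the removal of singularities.\<close>

lemma Schwarz_Lemma_le:
  assumes holf: "f holomorphic_on ball 0 1" and f0: "f 0 = 0"
    and le: "\<And>z. norm z < 1 \<Longrightarrow> norm (f z) \<le> 1" and \<xi>: "norm \<xi> < 1"
  shows "norm (f \<xi>) \<le> norm \<xi>"
proof (rule field_le_mult_one_interval)
  fix t :: real assume t: "0 < t" "t < 1"
  have "norm (of_real t * f \<xi>) \<le> norm \<xi>"
  proof (rule Schwarz_Lemma(1)[of "\<lambda>z. of_real t * f z"])
    show "norm (of_real t * f z) < 1" if "norm z < 1" for z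
      using order_le_less_trans[OF mult_left_le[OF le[OF that], of t]] t by (simp add: norm_mult)
  qed (use f0 \<xi> in \<open>auto intro!: holomorphic_intros holf\<close>)
  thus "t * norm (f \<xi>) \<le> norm \<xi>" using t by (simp add: norm_mult)
qed

text \<open>Positivity is assumed at every point, including poles of \<open>q\<close>, where \<open>q\<close> has a junk value; this lets
  the lemma apply without knowing that \<open>hyp2F1 a b c\<close> and the derivative of the ratio have no zeros in the disc.
  The Schwarz lemma is applied to \<open>(q - u) / (q + u)\<close> after removing its singularities.\<close>

lemma Harnack_meromorphic:
  assumes mero: "q meromorphic_on ball 0 1" and pos: "\<And>z. z \<in> ball 0 1 \<Longrightarrow> Re (q z) > 0"
    and ana: "q analytic_on {of_real r}" "q analytic_on {of_real x}"
    and val: "q (of_real r) = of_real u" "q (of_real x) = of_real v"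
    and xr: "0 \<le> x" "x < r" "r < 1"
  shows "u * (1 - r) * (1 + x) \<le> v * (1 - x) * (1 + r)"
proof -
  define \<phi> where "\<phi> z = (q z - of_real u) / (q z + of_real u)" for z
  have u: "u > 0" using pos[of "of_real r"] val xr by simp
  have v: "v > 0" using pos[of "of_real x"] val xr by simp
  have "norm (\<phi> z) \<le> 1" if "z \<in> ball 0 1" for z
  proof -
    \<comment> \<open>A point of the right half-plane is at least as close to \<open>u\<close> as to
      \<open>-u\<close>.\<close>
    have "(Re (q z) - u)\<^sup>2 \<le> (Re (q z) + u)\<^sup>2"
      using pos[OF that] u by (simp add: power2_eq_square algebra_simps)
    hence "norm (q z - of_real u) \<le> norm (q z + of_real u)"
      by (simp add: cmod_def)
    thus ?thesis by (simp add: \<phi>_def norm_divide divide_le_eq_1)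
  qed
  moreover have "\<phi> meromorphic_on ball 0 1"
    unfolding \<phi>_def by (intro meromorphic_intros mero)
  ultimately have hol: "remove_sings \<phi> holomorphic_on ball 0 1"
    and le: "\<And>z. z \<in> ball 0 1 \<Longrightarrow> norm (remove_sings \<phi> z) \<le> 1"
    using meromorphic_bounded_remove_sings[of \<phi> "ball 0 1" 1] by auto
  \<comment> \<open>Where \<open>q\<close> is analytic with a positive value, the denominator of
    \<open>\<phi>\<close> does not vanish, so removing singularities leaves the value
    unchanged.\<close>
  have \<phi>_ana: "remove_sings \<phi> (of_real y) = \<phi> (of_real y)"
    if "q analytic_on {of_real y}" "q (of_real y) = of_real w" "w > 0" for y w
    using that u unfolding \<phi>_def
    by (intro remove_sings_at_analytic analytic_intros) (auto simp flip: of_real_add)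
  \<comment> \<open>\<open>T z = (r - z) / (1 - r * z)\<close> is the involution of the disc that
    exchanges \<open>0\<close> and \<open>r\<close>; it moves the zero of \<open>\<phi>\<close> at
    \<open>r\<close> to the origin.\<close>
  define T where "T z = - Moebius_function 0 (of_real r) z" for z
  have T: "T z \<in> ball 0 1" if "norm z < 1" for z
    using Moebius_function_norm_lt_1[of "of_real r" z 0] that xr by (simp add: T_def)
  have T0: "T 0 = of_real r"
    by (simp add: T_def Moebius_function_def)
  \<comment> \<open>The preimage of \<open>x\<close> under \<open>T\<close>, which is the
    pseudohyperbolic distance of \<open>r\<close> and \<open>x\<close>.\<close>
  define w where "w = (r - x) / (1 - r * x)"
  have rx: "r * x < 1" using xr mult_strict_mono[of r 1 x 1] by (cases "x = 0") auto
  have w: "0 \<le> w" "w < 1" using xr rx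
    by (auto simp: w_def divide_less_eq)
      (smt (verit) mult_less_cancel_left2 mult.commute left_diff_distrib)
  have Tw: "T (of_real w) = of_real x"
  proof -
    have "1 - r * w = (1 - r\<^sup>2) / (1 - r * x)" "r - w = x * (1 - r\<^sup>2) / (1 - r * x)"
      using rx by (auto simp: w_def field_simps power2_eq_square)
    moreover have "1 - r\<^sup>2 \<noteq> 0" using xr by (auto simp: power2_eq_1_iff)
    ultimately have "(r - w) / (1 - r * w) = x" using rx by simp
    moreover have "T (of_real w) = of_real ((r - w) / (1 - r * w))"
      by (simp add: T_def Moebius_function_def minus_divide_left)
    ultimately show ?thesis by simp
  qed
  have "norm ((remove_sings \<phi> \<circ> T) (of_real w)) \<le> norm (complex_of_real w)"
  proof (rule Schwarz_Lemma_le)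
    have "T holomorphic_on ball 0 1"
      unfolding T_def using Moebius_function_holomorphic[of "of_real r" 0] xr
      by (intro holomorphic_intros) auto
    thus "remove_sings \<phi> \<circ> T holomorphic_on ball 0 1"
      using T by (intro holomorphic_on_compose_gen[OF _ hol]) auto
    show "(remove_sings \<phi> \<circ> T) 0 = 0"
      using \<phi>_ana[OF ana(1) val(1) u] by (simp add: T0 \<phi>_def val)
  qed (use T le w in auto)
  hence "\<bar>v - u\<bar> / \<bar>v + u\<bar> \<le> w"
    using \<phi>_ana[OF ana(2) val(2) v] w
    by (simp add: Tw \<phi>_def val flip: of_real_diff of_real_add of_real_divide)
  hence "(u - v) / (v + u) \<le> w"
    using u v by (simp add: divide_le_eq abs_le_iff)
  hence "(u - v) * (1 - r * x) \<le> (r - x) * (v + u)"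
    using u v rx by (simp add: w_def field_simps)
  \<comment> \<open>Collecting \<open>u\<close> and \<open>v\<close> gives
    \<open>1 - r * x - r + x = (1 - r) * (1 + x)\<close> and
    \<open>1 - r * x + r - x = (1 - x) * (1 + r)\<close>.\<close>
  thus ?thesis by (simp add: algebra_simps)
qed

subsection \<open>The Riccati equation\<close>

text \<open>The value of \<open>z * (1 - z) * Y'\<close> in terms of \<open>y = Y z\<close>. The
  linear coefficient \<open>c - (a + b) * z\<close> is expanded around the point 1, where the limits
  are taken.\<close>

definition riccati_rhs :: "'a :: field \<Rightarrow> 'a \<Rightarrow> 'a \<Rightarrow> 'a \<Rightarrow> 'a \<Rightarrow> 'a" where
  "riccati_rhs a b c z y = a * b * (1 - z) - ((c - a - b) + (a + b) * (1 - z)) * y - z * y\<^sup>2"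

text \<open>With \<open>w' = N / (a * (1 - z)\<^sup>2)\<close> and
  \<open>N = y + riccati_rhs a b c z y\<close>, logarithmic differentiation gives
  \<open>2 * z / (1 - z) + z * N' / N\<close>; in \<open>z * N'\<close> the derivative of
  \<open>Y\<close> is eliminated by the Riccati equation.\<close>

definition convexity_expr :: "'a :: field \<Rightarrow> 'a \<Rightarrow> 'a \<Rightarrow> 'a \<Rightarrow> 'a \<Rightarrow> 'a" where
  "convexity_expr a b c z y = 2 * z / (1 - z) +
     ((1 - (c - a - b) - (a + b) * (1 - z) - 2 * z * y) * riccati_rhs a b c z y / (1 - z)
      + z * ((a + b) * y - y\<^sup>2 - a * b)) / (y + riccati_rhs a b c z y)"

definition scaled_log_deriv :: "complex \<Rightarrow> complex \<Rightarrow> complex \<Rightarrow> complex \<Rightarrow> complex" where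
  "scaled_log_deriv a b c z = (1 - z) * hyp2F1' a b c z / hyp2F1 a b c z"

definition scaled_log_deriv_real :: "real \<Rightarrow> real \<Rightarrow> real \<Rightarrow> real \<Rightarrow> real" where
  "scaled_log_deriv_real a b c x =
     (1 - x) * (a * b / c * hyp2F1_real (a + 1) (b + 1) (c + 1) x) / hyp2F1_real a b c x"

section \<open>The ratio and its derivatives in terms of Y\<close>

context
  fixes a b c :: real
  assumes a: "a > 0" and b: "b > 0" and c: "c > 0"
begin

private abbreviation (input) "ca \<equiv> complex_of_real a"
private abbreviation (input) "cb \<equiv> complex_of_real b"
private abbreviation (input) "cc \<equiv> complex_of_real c"

text \<open>Writes \<open>Y\<close> as a quotient without derivatives, both for differentiating it
  and for reading off its limit at 1.\<close>

lemma hyp2F1_c_plus_1_scaled_log_deriv: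
  assumes z: "norm z < 1" and nz: "hyp2F1 ca cb cc z \<noteq> 0"
  shows "of_real ((c - a) * (c - b) / c) * (hyp2F1 ca cb (cc + 1) z / hyp2F1 ca cb cc z)
           = scaled_log_deriv ca cb cc z + (cc - ca - cb)"
proof -
  have "of_real ((c - a) * (c - b) / c) * (hyp2F1 ca cb (cc + 1) z / hyp2F1 ca cb cc z) =
      ((1 - z) * hyp2F1' ca cb cc z + of_real (c - a - b) * hyp2F1 ca cb cc z) / hyp2F1 ca cb cc z"
    unfolding hyp2F1'_c_plus_1[OF a b c z] by (rule times_divide_eq_right)
  thus ?thesis using nz by (simp add: scaled_log_deriv_def add_divide_distrib)
qed

text \<open>The formulas in \<open>Y\<close> hold off the zeros of \<open>hyp2F1\<close>; openness
  of this set allows them to be differentiated.\<close>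

lemma open_hyp2F1_nonzero: "open {z \<in> ball 0 1. hyp2F1 ca cb cc z \<noteq> 0}"
proof -
  have "open (ball 0 1 \<inter> hyp2F1 ca cb cc -` (- {0}))"
    using holomorphic_on_imp_continuous_on[OF hyp2F1_holomorphic[OF a b c]]
    by (intro continuous_open_preimage) auto
  also have "ball 0 1 \<inter> hyp2F1 ca cb cc -` (- {0}) = {z \<in> ball 0 1. hyp2F1 ca cb cc z \<noteq> 0}"
    by auto
  finally show ?thesis .
qed

text \<open>Differentiating \<open>Y = k * F1 / F - (c - a - b)\<close> involves only the first
  derivatives of \<open>F\<close> and \<open>F1\<close>, which the contiguous relations
  \<open>e1\<close>, \<open>e2\<close> and \<open>e3\<close> express through \<open>Y\<close> and
  \<open>F\<close>.\<close>

lemma scaled_log_deriv_riccati: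
  assumes z: "norm z < 1" and nz: "hyp2F1 ca cb cc z \<noteq> 0"
  obtains Y' where "(scaled_log_deriv ca cb cc has_field_derivative Y') (at z)"
    "z * (1 - z) * Y' = riccati_rhs ca cb cc z (scaled_log_deriv ca cb cc z)"
proof -
  define k where "k = complex_of_real ((c - a) * (c - b) / c)"
  define F F1 F' F1' Y where "F = hyp2F1 ca cb cc z" and "F1 = hyp2F1 ca cb (cc + 1) z"
    and "F' = hyp2F1' ca cb cc z" and "F1' = hyp2F1' ca cb (cc + 1) z"
    and "Y = scaled_log_deriv ca cb cc z"
  define Y' where "Y' = k * ((F1' * F - F1 * F') / (F * F))"
  have dF: "(hyp2F1 ca cb cc has_field_derivative F') (at z)"
    unfolding F'_def by (rule hyp2F1_has_field_derivative[OF a b c z])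
  have dF1: "(hyp2F1 ca cb (cc + 1) has_field_derivative F1') (at z)"
    unfolding F1'_def using hyp2F1_has_field_derivative[of a b "c + 1" z] a b c z by simp
  have "((\<lambda>z. k * (hyp2F1 ca cb (cc + 1) z / hyp2F1 ca cb cc z) - (cc - ca - cb)) has_field_derivative Y') (at z)"
    unfolding Y'_def F_def F1_def by (rule derivative_eq_intros dF dF1 nz refl)+ simp
  hence 1: "(scaled_log_deriv ca cb cc has_field_derivative Y') (at z)"
    by (rule has_field_derivative_transform_within_open[OF _ open_hyp2F1_nonzero])
       (use z nz hyp2F1_c_plus_1_scaled_log_deriv in \<open>auto simp: k_def\<close>)
  have kc: "k * cc = (cc - ca) * (cc - cb)"
    using c by (simp add: k_def)
  have e1: "k * F1 = (Y + (cc - ca - cb)) * F"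
    using hyp2F1_c_plus_1_scaled_log_deriv[OF z nz] nz
    unfolding F_def F1_def Y_def k_def[symmetric] times_divide_eq_right by (simp add: nonzero_divide_eq_eq)
  have e2: "(1 - z) * F' = Y * F"
    using nz by (simp add: Y_def scaled_log_deriv_def F'_def F_def)
  have e3: "z * F1' = cc * (F - F1)"
    using hyp2F1_c_plus_1[OF a b c z] unfolding F1'_def F_def F1_def by (simp add: algebra_simps)
  \<comment> \<open>The terms are grouped so that \<open>F1'\<close>, \<open>F'\<close> and
    \<open>F1\<close> occur only in the products that \<open>e3\<close>, \<open>e2\<close> and
    \<open>e1\<close> rewrite.\<close>
  have "z * (1 - z) * Y' * (F * F) = (1 - z) * k * (z * F1') * F - z * (k * F1) * ((1 - z) * F')"
    using nz by (simp add: Y'_def F_def) (simp add: algebra_simps)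
  also have "\<dots> = ((1 - z) * ((k * cc) * F - cc * (k * F1))) * F - z * (k * F1) * (Y * F)"
    unfolding e2 e3 by (simp add: algebra_simps)
  also have "\<dots> = riccati_rhs ca cb cc z Y * (F * F)"
    unfolding e1 kc riccati_rhs_def by (simp add: algebra_simps power2_eq_square)
  finally have 2: "z * (1 - z) * Y' = riccati_rhs ca cb cc z Y"
    using nz by (simp add: F_def)
  show ?thesis using that 1 2 by (simp add: Y_def)
qed

lemma hyp_ratio_scaled_log_deriv:
  assumes z: "norm z < 1" and nz: "hyp2F1 ca cb cc z \<noteq> 0"
  shows "hyp_ratio ca cb cc z = 1 + z * scaled_log_deriv ca cb cc z / (ca * (1 - z))"
proof -
  have "1 - z \<noteq> 0" using z by auto
  thus ?thesis
    using hyp2F1_a_plus_1[OF a b c z] a nz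
    by (simp add: hyp_ratio_def scaled_log_deriv_def divide_simps) (simp add: algebra_simps)
qed

text \<open>The quotient rule applied to \<open>1 + z * Y / (a * (1 - z))\<close> gives the
  numerator \<open>Y + z * (1 - z) * Y'\<close>, and the Riccati equation removes
  \<open>Y'\<close>.\<close>

lemma deriv_hyp_ratio:
  assumes z: "norm z < 1" and nz: "hyp2F1 ca cb cc z \<noteq> 0"
  defines "Y \<equiv> scaled_log_deriv ca cb cc z"
  shows "deriv (hyp_ratio ca cb cc) z = (Y + riccati_rhs ca cb cc z Y) / (ca * (1 - z)\<^sup>2)"
proof -
  obtain Y' where Y': "(scaled_log_deriv ca cb cc has_field_derivative Y') (at z)"
    "z * (1 - z) * Y' = riccati_rhs ca cb cc z Y"
    using scaled_log_deriv_riccati[OF z nz] unfolding Y_def by blast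
  have z1: "1 - z \<noteq> 0" using z by auto
  have "((\<lambda>z. 1 + z * scaled_log_deriv ca cb cc z / (ca * (1 - z))) has_field_derivative
     ((Y + z * Y') * (ca * (1 - z)) + z * Y * ca) / ((ca * (1 - z)) * (ca * (1 - z)))) (at z)"
    using z1 a by (auto intro!: derivative_eq_intros Y'(1) simp: Y_def algebra_simps)
  hence "(hyp_ratio ca cb cc has_field_derivative
     ((Y + z * Y') * (ca * (1 - z)) + z * Y * ca) / ((ca * (1 - z)) * (ca * (1 - z)))) (at z)"
    by (rule has_field_derivative_transform_within_open[OF _ open_hyp2F1_nonzero])
       (use z nz hyp_ratio_scaled_log_deriv in auto)
  hence "deriv (hyp_ratio ca cb cc) z =
     ((Y + z * Y') * (ca * (1 - z)) + z * Y * ca) / ((ca * (1 - z)) * (ca * (1 - z)))"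
    by (rule DERIV_imp_deriv)
  also have "(Y + z * Y') * (ca * (1 - z)) + z * Y * ca = ca * (Y + z * (1 - z) * Y')"
    by (simp add: algebra_simps)
  finally show ?thesis
    unfolding Y'(2) using z1 a by (simp add: power2_eq_square)
qed

lemma convexity_expr_hyp_ratio:
  assumes z: "norm z < 1" and nz: "hyp2F1 ca cb cc z \<noteq> 0"
  defines "Y \<equiv> scaled_log_deriv ca cb cc z"
  assumes N: "Y + riccati_rhs ca cb cc z Y \<noteq> 0"
  shows "z * deriv (deriv (hyp_ratio ca cb cc)) z / deriv (hyp_ratio ca cb cc) z = convexity_expr ca cb cc z Y"
proof -
  define K where "K = riccati_rhs ca cb cc z Y"
  \<comment> \<open>The partial derivative of \<open>y + riccati_rhs\<close> in \<open>y\<close>;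
    the bracket added in \<open>N'\<close> below is the partial derivative in
    \<open>z\<close>.\<close>
  define B where "B = 1 - (cc - ca - cb) - (ca + cb) * (1 - z) - 2 * z * Y"
  obtain Y' where Y': "(scaled_log_deriv ca cb cc has_field_derivative Y') (at z)" "z * (1 - z) * Y' = K"
    using scaled_log_deriv_riccati[OF z nz] unfolding Y_def K_def by blast
  define N' where "N' = B * Y' + ((ca + cb) * Y - Y\<^sup>2 - ca * cb)"
  have z1: "1 - z \<noteq> 0" using z by auto
  have dN: "((\<lambda>z. scaled_log_deriv ca cb cc z + riccati_rhs ca cb cc z (scaled_log_deriv ca cb cc z)) has_field_derivative N') (at z)"
    unfolding riccati_rhs_def N'_def B_def
    by (rule derivative_eq_intros Y'(1) refl)+ (simp add: Y_def algebra_simps power2_eq_square)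
  have dd: "((\<lambda>z. ca * (1 - z)\<^sup>2) has_field_derivative - (ca * (2 * (1 - z)))) (at z)"
    by (auto intro!: derivative_eq_intros simp: algebra_simps)
  have "((\<lambda>z. (scaled_log_deriv ca cb cc z + riccati_rhs ca cb cc z (scaled_log_deriv ca cb cc z)) / (ca * (1 - z)\<^sup>2))
     has_field_derivative (N' * (ca * (1 - z)\<^sup>2) + (Y + K) * (ca * (2 * (1 - z)))) / ((ca * (1 - z)\<^sup>2) * (ca * (1 - z)\<^sup>2))) (at z)"
    using DERIV_divide[OF dN dd] z1 a by (simp add: Y_def K_def)
  hence "(deriv (hyp_ratio ca cb cc) has_field_derivative
     (N' * (ca * (1 - z)\<^sup>2) + (Y + K) * (ca * (2 * (1 - z)))) / ((ca * (1 - z)\<^sup>2) * (ca * (1 - z)\<^sup>2))) (at z)"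
    by (rule has_field_derivative_transform_within_open[OF _ open_hyp2F1_nonzero])
       (use z nz deriv_hyp_ratio in auto)
  hence "deriv (deriv (hyp_ratio ca cb cc)) z =
     (N' * (ca * (1 - z)\<^sup>2) + (Y + K) * (ca * (2 * (1 - z)))) / ((ca * (1 - z)\<^sup>2) * (ca * (1 - z)\<^sup>2))"
    by (rule DERIV_imp_deriv)
  also have "\<dots> = (N' + (Y + K) * 2 / (1 - z)) / (ca * (1 - z)\<^sup>2)"
    using z1 a by (simp add: divide_simps) (simp add: algebra_simps power2_eq_square)
  finally have "z * deriv (deriv (hyp_ratio ca cb cc)) z / deriv (hyp_ratio ca cb cc) z =
      z * (N' + (Y + K) * 2 / (1 - z)) / (Y + K)"
    using z1 a unfolding deriv_hyp_ratio[OF z nz, folded Y_def, folded K_def] by simp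
  also have "\<dots> = 2 * z / (1 - z) + z * N' / (Y + K)"
    using N z1 unfolding K_def[symmetric] by (simp add: divide_simps) (simp add: algebra_simps)
  also have "z * N' = B * (z * Y') + z * ((ca + cb) * Y - Y\<^sup>2 - ca * cb)"
    unfolding N'_def by (simp add: algebra_simps)
  also have "z * Y' = K / (1 - z)" using Y'(2) z1 by (simp add: eq_divide_eq mult_ac)
  finally show ?thesis
    unfolding convexity_expr_def K_def[symmetric] B_def[symmetric] by simp
qed

text \<open>Meromorphy suffices for Harnack's inequality, so zeros of the denominator in the disc do
  no harm.\<close>

lemma hyp_ratio_meromorphic: "hyp_ratio ca cb cc meromorphic_on ball 0 1"
  unfolding hyp_ratio_def
  using hyp2F1_holomorphic[of "a + 1" b c] hyp2F1_holomorphic[OF a b c] a b c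
  by (intro meromorphic_intros analytic_on_imp_meromorphic_on) (auto simp: analytic_on_open)

lemma hyp_ratio_analytic:
  assumes z: "norm z < 1" and nz: "hyp2F1 ca cb cc z \<noteq> 0"
  shows "hyp_ratio ca cb cc analytic_on {z}"
  unfolding hyp_ratio_def
  using hyp2F1_holomorphic[of "a + 1" b c] hyp2F1_holomorphic[OF a b c] a b c z nz
  by (intro analytic_on_divide) (auto simp: analytic_on_open intro: analytic_on_subset[of _ "ball 0 1"])

context
  fixes x :: real
  assumes x: "0 \<le> x" "x < 1"
begin

lemma hyp2F1_of_real_nonzero: "hyp2F1 ca cb cc (of_real x) \<noteq> 0"
  using hyp2F1_of_real[OF a b c, of x] hyp2F1_real_ge_1[OF a b c, of x] x by simp

lemma scaled_log_deriv_of_real: "scaled_log_deriv ca cb cc (of_real x) = of_real (scaled_log_deriv_real a b c x)"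
proof -
  have "hyp2F1 (ca + 1) (cb + 1) (cc + 1) (of_real x) = of_real (hyp2F1_real (a + 1) (b + 1) (c + 1) x)"
    using hyp2F1_of_real[of "a + 1" "b + 1" "c + 1" x] a b c x by simp
  thus ?thesis
    using hyp2F1_of_real[OF a b c, of x] x
    by (simp add: scaled_log_deriv_def scaled_log_deriv_real_def hyp2F1'_def)
qed

text \<open>Provides the real values and the analyticity that \<open>Harnack_meromorphic\<close>
  asks for at its two points. The assumption says that \<open>w'\<close> does not vanish
  there.\<close>

lemma convexity_expr_hyp_ratio_of_real:
  assumes "scaled_log_deriv_real a b c x + riccati_rhs a b c x (scaled_log_deriv_real a b c x) \<noteq> 0"
  defines "h \<equiv> \<lambda>z. z * deriv (deriv (hyp_ratio ca cb cc)) z / deriv (hyp_ratio ca cb cc) z"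
  shows "h (of_real x) = of_real (convexity_expr a b c x (scaled_log_deriv_real a b c x))"
    and "h analytic_on {of_real x}"
proof -
  have z: "norm (complex_of_real x) < 1" using x by simp
  define Y where "Y = scaled_log_deriv_real a b c x"
  have R: "riccati_rhs ca cb cc (of_real x) (of_real Y) = of_real (riccati_rhs a b c x Y)"
    by (simp add: riccati_rhs_def)
  have N: "scaled_log_deriv ca cb cc (of_real x) + riccati_rhs ca cb cc (of_real x) (scaled_log_deriv ca cb cc (of_real x)) \<noteq> 0"
    using assms(1) unfolding scaled_log_deriv_of_real Y_def[symmetric] R
    by (metis of_real_add of_real_eq_0_iff)
  show "h (of_real x) = of_real (convexity_expr a b c x (scaled_log_deriv_real a b c x))"
    unfolding h_def convexity_expr_hyp_ratio[OF z hyp2F1_of_real_nonzero N]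
    unfolding scaled_log_deriv_of_real Y_def[symmetric] convexity_expr_def R by simp
  have "deriv (hyp_ratio ca cb cc) (of_real x) \<noteq> 0"
    unfolding deriv_hyp_ratio[OF z hyp2F1_of_real_nonzero] using N z a by auto
  thus "h analytic_on {of_real x}"
    unfolding h_def
    by (intro analytic_intros analytic_deriv hyp_ratio_analytic z hyp2F1_of_real_nonzero) auto
qed

end

end

subsection \<open>Behaviour at the point 1\<close>

text \<open>Serves the borderline case \<open>c = a + b\<close>, where the divergence at 1 is
  logarithmic and is obtained from the derivative.\<close>

lemma hyp2F1_real_has_field_derivative:
  fixes a b c x :: real
  assumes pos: "a > 0" "b > 0" "c > 0" and x: "\<bar>x\<bar> < 1"
  shows "(hyp2F1_real a b c has_field_derivative a * b / c * hyp2F1_real (a + 1) (b + 1) (c + 1) x) (at x)"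
proof -
  have "((\<lambda>z. \<Sum>n. hyp_coeff a b c n * z ^ n) has_field_derivative (\<Sum>n. diffs (hyp_coeff a b c) n * x ^ n)) (at x)"
    by (rule termdiffs_strong'[of 1]) (use summable_hyp2F1_real[OF pos] x in auto)
  moreover have "(\<lambda>z. \<Sum>n. hyp_coeff a b c n * z ^ n) = hyp2F1_real a b c"
    by (simp add: hyp2F1_real_def fun_eq_iff)
  moreover have "(\<lambda>n. a * b / c * (hyp_coeff (a + 1) (b + 1) (c + 1) n * x ^ n))
      sums (a * b / c * hyp2F1_real (a + 1) (b + 1) (c + 1) x)"
    unfolding hyp2F1_real_def by (intro sums_mult summable_sums summable_hyp2F1_real) (use pos x in auto)
  moreover have "diffs (hyp_coeff a b c) n = a * b / c * hyp_coeff (a + 1) (b + 1) (c + 1) n" for n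
    using diffs_hyp_coeff[OF pos, where ?'a = real] pos by simp
  ultimately show ?thesis
    by (simp add: sums_iff mult.assoc)
qed

lemma hyp2F1_real_c_plus_1_scaled_log_deriv_real:
  fixes a b c x :: real
  assumes pos: "a > 0" "b > 0" "c > 0" and x: "0 \<le> x" "x < 1"
  shows "scaled_log_deriv_real a b c x + (c - a - b) =
    (c - a) * (c - b) / c * (hyp2F1_real a b (c + 1) x / hyp2F1_real a b c x)"
proof -
  have F1: "hyp2F1 (of_real a) (of_real b) (of_real c + 1) (of_real x) = of_real (hyp2F1_real a b (c + 1) x)"
    using hyp2F1_of_real[of a b "c + 1" x] pos x by simp
  have F: "hyp2F1 (of_real a) (of_real b) (of_real c) (of_real x) = of_real (hyp2F1_real a b c x)"
    using hyp2F1_of_real[of a b c x] pos x by simp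
  have z: "norm (complex_of_real x) < 1" using x by simp
  have "complex_of_real (scaled_log_deriv_real a b c x + (c - a - b)) =
    of_real ((c - a) * (c - b) / c * (hyp2F1_real a b (c + 1) x / hyp2F1_real a b c x))"
    using hyp2F1_c_plus_1_scaled_log_deriv[OF pos z hyp2F1_of_real_nonzero[OF pos x]]
    unfolding F1 F scaled_log_deriv_of_real[OF pos x] by simp
  thus ?thesis by (simp only: of_real_eq_iff)
qed

lemma powr_one_minus_tendsto_0:
  fixes e :: real
  assumes "e > 0"
  shows "((\<lambda>x. (1 - x) powr e) \<longlongrightarrow> 0) (at_left 1)"
  using assms by real_asymp

lemma powr_one_minus_at_top:
  fixes e :: real
  assumes "e < 0"
  shows "filterlim (\<lambda>x. (1 - x) powr e) at_top (at_left 1)"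
  using assms by real_asymp

lemma eventually_at_left_1: "eventually (\<lambda>x. 0 < x \<and> x < 1) (at_left (1 :: real))"
  by (rule eventually_at_leftI[of 0]) auto

section \<open>Limits of Y at 1\<close>

context
  fixes a b c :: real
  assumes a: "a > 0" and b: "b > 0" and c: "c > 0"
begin

private abbreviation (input) "Y \<equiv> scaled_log_deriv_real a b c"
private abbreviation (input) "\<delta> \<equiv> c - a - b"
private abbreviation (input) "\<Phi> \<equiv> hyp2F1_real a b c"

text \<open>Here \<open>Y + \<delta> = k * F1 / \<Phi>\<close> with \<open>k > 0\<close>, and
  \<open>\<Phi>\<close> has exact order \<open>(1 - x) powr (-s)\<close>. Slow growth of
  \<open>F1\<close> gives the limit; \<open>F1 \<ge> 1\<close> gives a lower bound of order
  \<open>(1 - x) powr s\<close>, which still diverges after division by \<open>1 - x\<close> because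
  \<open>s < 1\<close>.\<close>

lemma scaled_log_deriv_real_asymp_neg:
  assumes \<delta>: "-1 < \<delta>" "\<delta> < 0" and cab: "(c - a) * (c - b) > 0"
  shows "(Y \<longlongrightarrow> -\<delta>) (at_left 1)"
    and "filterlim (\<lambda>x. (Y x + \<delta>) / (1 - x)) at_top (at_left 1)"
proof -
  define s where "s = -\<delta>"
  have s: "0 < s" "s < 1" using \<delta> by (auto simp: s_def)
  define k where "k = (c - a) * (c - b) / c"
  have k: "k > 0" using cab c by (simp add: k_def)
  define F1 where "F1 = hyp2F1_real a b (c + 1)"
  have eq: "Y x + \<delta> = k * (F1 x / \<Phi> x)" if "0 < x \<and> x < 1" for x
    using hyp2F1_real_c_plus_1_scaled_log_deriv_real[OF a b c, of x] that by (simp add: k_def F1_def)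
  obtain C where C: "C > 0" "\<And>x. 0 \<le> x \<Longrightarrow> x < 1 \<Longrightarrow> \<Phi> x \<le> C * (1 - x) powr (-s)"
    using hyp2F1_real_le[OF a b c, of s] s by (auto simp: s_def)
  obtain D where D: "D > 0" "\<And>x. 0 \<le> x \<Longrightarrow> x < 1 \<Longrightarrow> \<Phi> x \<ge> D * (1 - x) powr (-s)"
    using hyp2F1_real_ge[OF a b c, of s] s by (auto simp: s_def)
  \<comment> \<open>The comparison needs a positive exponent; any one below \<open>s\<close> makes
    \<open>F1 / \<Phi>\<close> tend to 0, and \<open>s / 2\<close> is such a choice.\<close>
  obtain E where E: "E > 0" "\<And>x. 0 \<le> x \<Longrightarrow> x < 1 \<Longrightarrow> F1 x \<le> E * (1 - x) powr (-(s/2))"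
  proof (rule hyp2F1_real_le[of a b "c + 1" "s / 2"])
    show "a + b \<le> c + 1 + s / 2" using s by (simp add: s_def field_simps)
  qed (use a b c s in \<open>auto simp: F1_def\<close>)
  have F1: "F1 x \<ge> 1" if "0 < x \<and> x < 1" for x
    using hyp2F1_real_ge_1[of a b "c + 1" x] a b c that by (simp add: F1_def)
  have \<Phi>: "\<Phi> x \<ge> 1" if "0 < x \<and> x < 1" for x
    using hyp2F1_real_ge_1[of a b c x] a b c that by simp
  have bd: "0 \<le> Y x + \<delta> \<and> Y x + \<delta> \<le> k * E / D * (1 - x) powr (s/2)
      \<and> (Y x + \<delta>) / (1 - x) \<ge> k / C * (1 - x) powr (s - 1)" if x: "0 < x \<and> x < 1" for x
  proof (intro conjI)
    show "0 \<le> Y x + \<delta>" using eq[OF x] k F1[OF x] \<Phi>[OF x] by simp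
    have "F1 x / \<Phi> x \<le> (E * (1 - x) powr (-(s/2))) / (D * (1 - x) powr (-s))"
      using D E F1[OF x] x by (intro frac_le) auto
    also have "\<dots> = E / D * (1 - x) powr (s / 2)"
      using x D(1) powr_add[of "1 - x" "-s" "s/2"] by (simp add: field_simps)
    finally show "Y x + \<delta> \<le> k * E / D * (1 - x) powr (s/2)"
      using eq[OF x] k mult_left_mono[of _ _ k] by fastforce
    have "1 / (C * (1 - x) powr (-s)) \<le> F1 x / \<Phi> x"
      using C F1[OF x] \<Phi>[OF x] x by (intro frac_le) auto
    hence "k * (1 / (C * (1 - x) powr (-s))) / (1 - x) \<le> (Y x + \<delta>) / (1 - x)"
      unfolding eq[OF x] using k x by (intro divide_right_mono mult_left_mono) auto
    also have "k * (1 / (C * (1 - x) powr (-s))) / (1 - x) = k / C * (1 - x) powr (s - 1)"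
      using x by (simp add: powr_minus powr_diff divide_simps)
    finally show "(Y x + \<delta>) / (1 - x) \<ge> k / C * (1 - x) powr (s - 1)" .
  qed
  have "((\<lambda>x. Y x + \<delta>) \<longlongrightarrow> 0) (at_left 1)"
  proof (rule tendsto_sandwich[of "\<lambda>_. 0" _ _ "\<lambda>x. k * E / D * (1 - x) powr (s/2)"])
    show "((\<lambda>x. k * E / D * (1 - x) powr (s/2)) \<longlongrightarrow> 0) (at_left 1)"
      by (rule tendsto_mult_right_zero powr_one_minus_tendsto_0)+ (use s in simp)
  qed (use bd in \<open>auto intro!: eventually_mono[OF eventually_at_left_1] tendsto_const\<close>)
  from tendsto_add[OF this tendsto_const[of "-\<delta>"]] show "(Y \<longlongrightarrow> -\<delta>) (at_left 1)"
    by simp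
  have "filterlim (\<lambda>x. k / C * (1 - x) powr (s - 1)) at_top (at_left 1)"
    by (rule filterlim_tendsto_pos_mult_at_top[OF tendsto_const _ powr_one_minus_at_top])
       (use k C s in auto)
  thus "filterlim (\<lambda>x. (Y x + \<delta>) / (1 - x)) at_top (at_left 1)"
    by (rule filterlim_at_top_mono) (use bd in \<open>auto intro!: eventually_mono[OF eventually_at_left_1]\<close>)
qed

text \<open>The derivative \<open>F'\<close> has exact order
  \<open>(1 - x) powr (-(1 - \<delta>))\<close>, while \<open>\<Phi>\<close> grows more slowly than
  the chosen power with exponent \<open>-\<epsilon>\<close>. So \<open>Y\<close> is at least of
  order \<open>(1 - x) powr (\<delta> + \<epsilon>)\<close> and at most of order
  \<open>(1 - x) powr \<delta> / \<Phi> x\<close>.\<close>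

lemma scaled_log_deriv_real_asymp_nonneg:
  assumes \<delta>: "0 \<le> \<delta>" "\<delta> < 1 / 2"
  shows "(Y \<longlongrightarrow> 0) (at_left 1)"
    and "((\<lambda>x. (1 - x) / (Y x)\<^sup>2) \<longlongrightarrow> 0) (at_left 1)"
    and "eventually (\<lambda>x. Y x > 0) (at_left 1)"
proof -
  \<comment> \<open>Chosen so that
    \<open>2 * (\<delta> + \<epsilon>) = 1 / 2 + \<delta> < 1\<close>; then \<open>1 - x\<close> is
    still small against the square of the lower bound for \<open>Y\<close>.\<close>
  define \<epsilon> where "\<epsilon> = (1 / 2 - \<delta>) / 2"
  have \<epsilon>: "\<epsilon> > 0" using \<delta> by (simp add: \<epsilon>_def)
  define F' where "F' x = a * b / c * hyp2F1_real (a + 1) (b + 1) (c + 1) x" for x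
  define k where "k = a * b / c"
  have k: "k > 0" using a b c by (simp add: k_def)
  have Y: "Y x = (1 - x) * F' x / \<Phi> x" for x
    by (simp add: scaled_log_deriv_real_def F'_def)
  obtain C where C: "C > 0" "\<And>x. 0 \<le> x \<Longrightarrow> x < 1 \<Longrightarrow> \<Phi> x \<le> C * (1 - x) powr (-\<epsilon>)"
  proof (rule hyp2F1_real_le[OF a b c \<epsilon>])
    show "a + b \<le> c + \<epsilon>" using \<delta> \<epsilon> by simp
  qed auto
  obtain D where D: "D > 0" "\<And>x. 0 \<le> x \<Longrightarrow> x < 1 \<Longrightarrow> F' x \<ge> D * (1 - x) powr (-(1 - \<delta>))"
  proof -
    obtain D where "D > 0" "\<And>x. 0 \<le> x \<Longrightarrow> x < 1 \<Longrightarrow>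
        hyp2F1_real (a + 1) (b + 1) (c + 1) x \<ge> D * (1 - x) powr (-(1 - \<delta>))"
      using hyp2F1_real_ge[of "a + 1" "b + 1" "c + 1" "1 - \<delta>"] a b c \<delta> by auto
    thus ?thesis using that[of "k * D"] k
      by (simp add: F'_def mult.assoc mult_le_cancel_left_pos flip: k_def)
  qed
  obtain E where E: "E > 0" "\<And>x. 0 \<le> x \<Longrightarrow> x < 1 \<Longrightarrow> F' x \<le> E * (1 - x) powr (-(1 - \<delta>))"
  proof -
    obtain D where "D > 0" "\<And>x. 0 \<le> x \<Longrightarrow> x < 1 \<Longrightarrow>
        hyp2F1_real (a + 1) (b + 1) (c + 1) x \<le> D * (1 - x) powr (-(1 - \<delta>))"
      using hyp2F1_real_le[of "a + 1" "b + 1" "c + 1" "1 - \<delta>"] a b c \<delta> by auto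
    thus ?thesis using that[of "k * D"] k
      by (simp add: F'_def mult.assoc mult_le_cancel_left_pos flip: k_def)
  qed
  have \<Phi>: "\<Phi> x \<ge> 1" if "0 < x \<and> x < 1" for x
    using hyp2F1_real_ge_1[of a b c x] a b c that by simp
  have lower: "Y x \<ge> D / C * (1 - x) powr (\<delta> + \<epsilon>)" if x: "0 < x \<and> x < 1" for x
  proof -
    have "((1 - x) * (D * (1 - x) powr (-(1 - \<delta>)))) / (C * (1 - x) powr (-\<epsilon>)) \<le> Y x"
      unfolding Y using C(2)[of x] D \<Phi>[OF x] x
      by (intro frac_le mult_left_mono mult_nonneg_nonneg order_trans[OF _ D(2)]) auto
    also have "((1 - x) * (D * (1 - x) powr (-(1 - \<delta>)))) / (C * (1 - x) powr (-\<epsilon>)) =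
        D / C * (1 - x) powr (\<delta> + \<epsilon>)"
      using x by (simp add: powr_minus powr_diff powr_add divide_simps)
    finally show ?thesis .
  qed
  have Ypos: "Y x > 0" if x: "0 < x \<and> x < 1" for x
    by (rule less_le_trans[OF _ lower[OF x]]) (use C D x in auto)
  thus "eventually (\<lambda>x. Y x > 0) (at_left 1)"
    by (auto intro!: eventually_mono[OF eventually_at_left_1])
  have upper: "Y x \<le> E * (1 - x) powr \<delta> / \<Phi> x" if x: "0 < x \<and> x < 1" for x
  proof -
    have "Y x \<le> (1 - x) * (E * (1 - x) powr (-(1 - \<delta>))) / \<Phi> x"
      unfolding Y using E(2)[of x] \<Phi>[OF x] x
      by (intro divide_right_mono mult_left_mono) auto
    also have "(1 - x) * (E * (1 - x) powr (-(1 - \<delta>))) = E * (1 - x) powr \<delta>"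
      using x by (simp add: powr_minus powr_diff powr_add divide_simps)
    finally show ?thesis .
  qed
  show "((\<lambda>x. (1 - x) / (Y x)\<^sup>2) \<longlongrightarrow> 0) (at_left 1)"
  proof (rule tendsto_sandwich[of "\<lambda>_. 0" _ _ "\<lambda>x. (C / D)\<^sup>2 * (1 - x) powr (1 / 2 - \<delta>)"])
    show "((\<lambda>x. (C / D)\<^sup>2 * (1 - x) powr (1 / 2 - \<delta>)) \<longlongrightarrow> 0) (at_left 1)"
      by (rule tendsto_mult_right_zero powr_one_minus_tendsto_0)+ (use \<delta> in simp)
    have "(1 - x) / (Y x)\<^sup>2 \<le> (C / D)\<^sup>2 * (1 - x) powr (1 / 2 - \<delta>)" if x: "0 < x \<and> x < 1" for x
    proof -
      have "(1 - x) / (Y x)\<^sup>2 \<le> (1 - x) / (D / C * (1 - x) powr (\<delta> + \<epsilon>))\<^sup>2"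
        using lower[OF x] C D x by (intro divide_left_mono power_mono mult_pos_pos zero_less_power Ypos) auto
      also have "\<dots> = (C / D)\<^sup>2 * ((1 - x) / ((1 - x) powr (\<delta> + \<epsilon>))\<^sup>2)"
        by (simp add: power_divide power_mult_distrib)
      also have "((1 - x) powr (\<delta> + \<epsilon>))\<^sup>2 = (1 - x) powr (1 / 2 + \<delta>)"
      proof -
        have "(\<delta> + \<epsilon>) + (\<delta> + \<epsilon>) = 1 / 2 + \<delta>" unfolding \<epsilon>_def by (simp add: field_simps)
        thus ?thesis by (simp only: power2_eq_square powr_add[symmetric])
      qed
      also have "(1 - x) / (1 - x) powr (1 / 2 + \<delta>) = (1 - x) powr (1 - (1 / 2 + \<delta>))"
        using x by (subst powr_diff) simp
      finally show ?thesis by (simp add: field_simps)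
    qed
    thus "eventually (\<lambda>x. (1 - x) / (Y x)\<^sup>2 \<le> (C / D)\<^sup>2 * (1 - x) powr (1 / 2 - \<delta>)) (at_left 1)"
      by (auto intro!: eventually_mono[OF eventually_at_left_1])
  qed (auto intro!: eventually_mono[OF eventually_at_left_1])
  show "(Y \<longlongrightarrow> 0) (at_left 1)"
  proof (cases "\<delta> = 0")
    case False
    have "Y x \<le> E * (1 - x) powr \<delta>" if x: "0 < x \<and> x < 1" for x
      using upper[OF x] \<Phi>[OF x] E(1) x frac_le[of "E * (1 - x) powr \<delta>" "E * (1 - x) powr \<delta>" 1 "\<Phi> x"] by simp
    moreover have "((\<lambda>x. E * (1 - x) powr \<delta>) \<longlongrightarrow> 0) (at_left 1)"
      by (rule tendsto_mult_right_zero powr_one_minus_tendsto_0)+ (use \<delta> False in simp)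
    ultimately show ?thesis
      by (intro tendsto_sandwich[of "\<lambda>_. 0" Y _ "\<lambda>x. E * (1 - x) powr \<delta>"])
         (auto intro!: eventually_mono[OF eventually_at_left_1] less_imp_le[OF Ypos])
  next
    case True
    \<comment> \<open>For \<open>\<delta> = 0\<close> the upper bound is
      \<open>E / \<Phi> x\<close>, so \<open>\<Phi>\<close> must diverge. From
      \<open>F' x \<ge> D / (1 - x)\<close> the function \<open>\<Phi> x + D * ln (1 - x)\<close> is
      nondecreasing.\<close>
    have low: "\<Phi> x \<ge> 1 - D * ln (1 - x)" if x: "0 < x \<and> x < 1" for x
    proof -
      have "\<Phi> 0 + D * ln (1 - 0) \<le> \<Phi> x + D * ln (1 - x)"
      proof (rule DERIV_nonneg_imp_nondecreasing[of 0 x "\<lambda>x. \<Phi> x + D * ln (1 - x)"])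
        fix y assume y: "0 \<le> y" "y \<le> x"
        have "((\<lambda>x. \<Phi> x + D * ln (1 - x)) has_field_derivative F' y + D * (- 1 / (1 - y))) (at y)"
          using y x unfolding F'_def
          by (auto intro!: derivative_eq_intros hyp2F1_real_has_field_derivative a b c)
        moreover have "F' y + D * (- 1 / (1 - y)) \<ge> 0"
          using D(2)[of y] y x True by (simp add: powr_minus divide_simps)
        ultimately show "\<exists>y'. ((\<lambda>x. \<Phi> x + D * ln (1 - x)) has_field_derivative y') (at y) \<and> 0 \<le> y'"
          by blast
      qed (use x in auto)
      moreover have "\<Phi> 0 \<ge> 1" using hyp2F1_real_ge_1[OF a b c, of 0] by simp
      ultimately show ?thesis by simp
    qed
    have "filterlim (\<lambda>x. 1 - D * ln (1 - x)) at_top (at_left 1)"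
      using D(1) by real_asymp
    hence "filterlim \<Phi> at_top (at_left 1)"
      by (rule filterlim_at_top_mono) (use low in \<open>auto intro!: eventually_mono[OF eventually_at_left_1]\<close>)
    hence "((\<lambda>x. E / \<Phi> x) \<longlongrightarrow> 0) (at_left 1)"
      by (intro tendsto_divide_0[OF tendsto_const] filterlim_at_top_imp_at_infinity)
    moreover have "Y x \<le> E / \<Phi> x" if x: "0 < x \<and> x < 1" for x
      using upper[OF x] x unfolding True by simp
    ultimately show ?thesis
      by (intro tendsto_sandwich[of "\<lambda>_. 0" Y _ "\<lambda>x. E / \<Phi> x"])
         (auto intro!: eventually_mono[OF eventually_at_left_1] less_imp_le[OF Ypos])
  qed
qed

section \<open>Limits of the convexity expression at 1\<close>

private abbreviation (input) "h x \<equiv> convexity_expr a b c x (scaled_log_deriv_real a b c x)"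
private abbreviation (input) "K x \<equiv> riccati_rhs a b c x (scaled_log_deriv_real a b c x)"

text \<open>Since \<open>K\<close> tends to 0 and \<open>Y + K\<close> to
  \<open>-\<delta> > 0\<close>, the pole \<open>2 * x / (1 - x)\<close> dominates. The next term is
  \<open>(Y x + \<delta>) / (1 - x)\<close>, which diverges, with a coefficient tending to
  \<open>-(1 + \<delta>) < 0\<close>.\<close>

lemma convexity_expr_asymp_neg:
  assumes \<delta>: "-1 < \<delta>" "\<delta> < 0" and cab: "(c - a) * (c - b) > 0"
  shows "((\<lambda>x. (1 - x) * h x) \<longlongrightarrow> 2) (at_left 1)"
    and "filterlim (\<lambda>x. h x - 2 / (1 - x)) at_bot (at_left 1)"
    and "eventually (\<lambda>x. Y x + K x \<noteq> 0) (at_left 1)"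
proof -
  note Y = scaled_log_deriv_real_asymp_neg[OF \<delta> cab]
  have id: "((\<lambda>x :: real. x) \<longlongrightarrow> 1) (at_left 1)"
    by (rule tendsto_ident_at)
  have K: "(K \<longlongrightarrow> 0) (at_left 1)"
    unfolding riccati_rhs_def
    by (rule tendsto_eq_intros Y(1) id refl)+ (simp add: power2_eq_square algebra_simps)
  have N: "((\<lambda>x. Y x + K x) \<longlongrightarrow> -\<delta>) (at_left 1)"
    using tendsto_add[OF Y(1) K] by simp
  have "eventually (\<lambda>x. Y x + K x > 0) (at_left 1)"
    using order_tendstoD(1)[OF N, of 0] \<delta> by simp
  thus nz: "eventually (\<lambda>x. Y x + K x \<noteq> 0) (at_left 1)"
    by eventually_elim simp
  define B where "B x = 1 - \<delta> - (a + b) * (1 - x) - 2 * x * Y x" for x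
  define R where "R x = (a + b) * Y x - (Y x)\<^sup>2 - a * b" for x
  have B: "(B \<longlongrightarrow> 1 + \<delta>) (at_left 1)"
    unfolding B_def by (rule tendsto_eq_intros Y(1) id refl)+ (simp add: algebra_simps)
  have R: "(R \<longlongrightarrow> (a + b) * (-\<delta>) - (-\<delta>)\<^sup>2 - a * b) (at_left 1)"
    unfolding R_def by (rule tendsto_eq_intros Y(1) refl)+
  have h: "h x = 2 * x / (1 - x) + (B x * K x / (1 - x) + x * R x) / (Y x + K x)" for x
    unfolding convexity_expr_def B_def R_def by simp
  have "((\<lambda>x. 2 * x + (B x * K x + x * R x * (1 - x)) / (Y x + K x)) \<longlongrightarrow> 2) (at_left 1)"
    by (rule tendsto_eq_intros B K R N id refl)+ (use \<delta> in auto)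
  thus "((\<lambda>x. (1 - x) * h x) \<longlongrightarrow> 2) (at_left 1)"
  proof (rule Lim_transform_eventually)
    show "eventually (\<lambda>x. 2 * x + (B x * K x + x * R x * (1 - x)) / (Y x + K x) = (1 - x) * h x) (at_left 1)"
      using eventually_at_left_1 nz
    proof eventually_elim
      case (elim x)
      have "h x = (2 * x + (B x * K x + x * R x * (1 - x)) / (Y x + K x)) / (1 - x)"
        unfolding h using elim by (simp add: add_divide_distrib mult_ac)
      thus ?case using elim by simp
    qed
  qed
  \<comment> \<open>Collects the part of \<open>h x - 2 / (1 - x)\<close> that has a finite limit;
    its \<open>-2\<close> comes from \<open>2 * x / (1 - x) = 2 / (1 - x) - 2\<close>.\<close>
  define Q where "Q x = -2 + (B x * (a * b - (a + b) * Y x + (Y x)\<^sup>2) + x * R x) / (Y x + K x)" for x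
  have q: "(Q \<longlongrightarrow> -2 + ((1 + \<delta>) * (a * b - (a + b) * (-\<delta>) + (-\<delta>)\<^sup>2) +
      1 * ((a + b) * (-\<delta>) - (-\<delta>)\<^sup>2 - a * b)) / (-\<delta>)) (at_left 1)"
    unfolding Q_def by (intro tendsto_intros B R N Y(1)) (use \<delta> in simp)
  have "((\<lambda>x. - (B x * Y x / (Y x + K x))) \<longlongrightarrow> - (1 + \<delta>)) (at_left 1)"
    by (rule tendsto_eq_intros B N Y(1) refl)+ (use \<delta> in auto)
  hence "filterlim (\<lambda>x. - (B x * Y x / (Y x + K x)) * ((Y x + \<delta>) / (1 - x))) at_bot (at_left 1)"
    by (rule filterlim_tendsto_neg_mult_at_bot[OF _ _ Y(2)]) (use \<delta> in simp)
  hence "filterlim (\<lambda>x. Q x + - (B x * Y x / (Y x + K x)) * ((Y x + \<delta>) / (1 - x))) at_bot (at_left 1)"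
    unfolding filterlim_tendsto_add_at_bot_iff[OF q] .
  moreover have "eventually (\<lambda>x. Q x + - (B x * Y x / (Y x + K x)) * ((Y x + \<delta>) / (1 - x)) =
      h x - 2 / (1 - x)) (at_left 1)"
    using eventually_at_left_1 nz
  proof eventually_elim
    case (elim x)
    define t where "t = (Y x + \<delta>) / (1 - x)"
    have t: "t * (1 - x) = Y x + \<delta>" using elim by (simp add: t_def)
    have "K x = (1 - x) * (a * b - (a + b) * Y x + (Y x)\<^sup>2 - Y x * t)"
      using t unfolding riccati_rhs_def by algebra
    hence "K x / (1 - x) = a * b - (a + b) * Y x + (Y x)\<^sup>2 - Y x * t"
      using elim by simp
    moreover have "2 * x / (1 - x) = 2 / (1 - x) - 2" using elim by (simp add: divide_simps)
    ultimately show ?case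
      unfolding h Q_def t_def[symmetric] times_divide_eq_right[symmetric]
      by (simp add: diff_divide_distrib add_divide_distrib ring_distribs)
  qed
  ultimately show "filterlim (\<lambda>x. h x - 2 / (1 - x)) at_bot (at_left 1)"
    using filterlim_cong[OF refl refl] by fast
qed

text \<open>Now \<open>Y\<close> tends to 0, so everything is expanded in \<open>Y\<close> with
  \<open>1 - x = t x * (Y x)\<^sup>2\<close> and \<open>t\<close> tending to 0. The result is
  \<open>h x = (2 - \<delta>) / (1 - x) - 2 + S x * (Y x / (1 - x))\<close>, where the limit of
  \<open>S\<close> is negative because \<open>1 - 2 * \<delta> > 0\<close>.\<close>

lemma convexity_expr_asymp_nonneg:
  assumes \<delta>: "0 \<le> \<delta>" "\<delta> < 1 / 2"
  shows "((\<lambda>x. (1 - x) * h x) \<longlongrightarrow> 2 - \<delta>) (at_left 1)"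
    and "filterlim (\<lambda>x. h x - (2 - \<delta>) / (1 - x)) at_bot (at_left 1)"
    and "eventually (\<lambda>x. Y x + K x \<noteq> 0) (at_left 1)"
proof -
  define t where "t x = (1 - x) / (Y x)\<^sup>2" for x
  have Y: "(Y \<longlongrightarrow> 0) (at_left 1)" and t: "(t \<longlongrightarrow> 0) (at_left 1)"
    and Ypos: "eventually (\<lambda>x. Y x > 0) (at_left 1)"
    using scaled_log_deriv_real_asymp_nonneg[OF \<delta>] by (simp_all add: t_def [abs_def])
  have id: "((\<lambda>x :: real. x) \<longlongrightarrow> 1) (at_left 1)"
    by (rule tendsto_ident_at)
  define A where "A x = a * b * t x - (a + b) * t x * Y x - x" for x
  define B where "B x = 1 - \<delta> - (a + b) * (1 - x) - 2 * x * Y x" for x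
  define R where "R x = (a + b) * Y x - (Y x)\<^sup>2 - a * b" for x
  define N where "N x = 1 - \<delta> + Y x * A x" for x
  define S where "S x = ((B x + \<delta>) * A x + \<delta> * ((a + b) * t x * Y x + 2 * x) + x * t x * R x) / N x" for x
  have A: "(A \<longlongrightarrow> -1) (at_left 1)"
    unfolding A_def by (rule tendsto_eq_intros t Y id refl)+ simp
  have B: "(B \<longlongrightarrow> 1 - \<delta>) (at_left 1)"
    unfolding B_def by (rule tendsto_eq_intros t Y id refl)+ simp
  have R: "(R \<longlongrightarrow> - a * b) (at_left 1)"
    unfolding R_def by (rule tendsto_eq_intros Y refl)+ simp
  have N: "(N \<longlongrightarrow> 1 - \<delta>) (at_left 1)"
    unfolding N_def by (rule tendsto_eq_intros Y A refl)+ simp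
  have S: "(S \<longlongrightarrow> - ((1 - 2 * \<delta>) / (1 - \<delta>))) (at_left 1)"
    unfolding S_def by (rule tendsto_eq_intros A B R N Y t id refl)+ (use \<delta> in \<open>auto simp: divide_simps\<close>)
  have Npos: "eventually (\<lambda>x. N x > 0) (at_left 1)"
    using order_tendstoD(1)[OF N, of 0] \<delta> by simp
  have ev: "eventually (\<lambda>x. 0 < x \<and> x < 1 \<and> Y x > 0 \<and> N x > 0) (at_left 1)"
    using eventually_at_left_1 Ypos Npos by eventually_elim simp
  have K: "K x = (Y x)\<^sup>2 * A x - \<delta> * Y x" if "Y x > 0" for x
  proof -
    have "1 - x = t x * (Y x)\<^sup>2" using that by (simp add: t_def)
    thus ?thesis unfolding riccati_rhs_def A_def by algebra
  qed
  have YK: "Y x + K x = Y x * N x" if "Y x > 0" for x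
    unfolding K[OF that] N_def by (simp add: power2_eq_square algebra_simps)
  from ev show "eventually (\<lambda>x. Y x + K x \<noteq> 0) (at_left 1)"
    by eventually_elim (simp add: YK)
  have h: "h x - (2 - \<delta>) / (1 - x) = -2 + S x * (Y x / (1 - x))"
    if x: "0 < x \<and> x < 1 \<and> Y x > 0 \<and> N x > 0" for x
  proof -
    have u: "1 - x = t x * (Y x)\<^sup>2" using x by (simp add: t_def)
    \<comment> \<open>Adding \<open>\<delta> * (Y x * N x)\<close> cancels the terms of first order
      in \<open>Y\<close>, so that \<open>(Y x)\<^sup>2\<close> factors out.\<close>
    have "B x * K x + x * R x * (1 - x) + \<delta> * (Y x * N x) = (Y x)\<^sup>2 * (S x * N x)"
    proof -
      have "S x * N x = (B x + \<delta>) * A x + \<delta> * ((a + b) * t x * Y x + 2 * x) + x * t x * R x"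
        using x by (simp add: S_def)
      moreover have "B x = 1 - \<delta> - (a + b) * (t x * (Y x)\<^sup>2) - 2 * x * Y x"
        unfolding B_def u[symmetric] by simp
      moreover have "K x = (Y x)\<^sup>2 * A x - \<delta> * Y x" using K x by blast
      ultimately show ?thesis using u N_def[of x] by algebra
    qed
    hence "(B x * K x + x * R x * (1 - x)) / (Y x * N x) = S x * Y x - \<delta>"
      using x by (simp add: divide_simps power2_eq_square) (simp add: algebra_simps)
    moreover have "h x = (2 * x + (B x * K x + x * R x * (1 - x)) / (Y x + K x)) / (1 - x)"
      unfolding convexity_expr_def B_def R_def using x YK[of x] by (simp add: add_divide_distrib mult_ac)
    ultimately have "h x = (2 * x + S x * Y x - \<delta>) / (1 - x)"
      using YK[of x] x by simp
    thus ?thesis using x by (simp add: divide_simps)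
  qed
  have lim: "((\<lambda>x. 2 - \<delta> - 2 * (1 - x) + S x * Y x) \<longlongrightarrow> 2 - \<delta>) (at_left 1)"
    by (rule tendsto_eq_intros S Y id refl)+ simp
  show "((\<lambda>x. (1 - x) * h x) \<longlongrightarrow> 2 - \<delta>) (at_left 1)"
  proof (rule Lim_transform_eventually[OF lim])
    show "eventually (\<lambda>x. 2 - \<delta> - 2 * (1 - x) + S x * Y x = (1 - x) * h x) (at_left 1)"
      using ev
    proof eventually_elim
      case (elim x)
      have "(1 - x) * h x = (1 - x) * ((2 - \<delta>) / (1 - x)) - 2 * (1 - x) + S x * ((1 - x) * (Y x / (1 - x)))"
        using h[OF elim] by algebra
      thus ?case using elim by simp
    qed
  qed
  \<comment> \<open>\<open>Y x / (1 - x)\<close> is the reciprocal of \<open>t x * Y x\<close>,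
    which tends to 0 from above.\<close>
  have "filterlim (\<lambda>x. t x * Y x) (at_right 0) (at_left 1)"
  proof (rule tendsto_imp_filterlim_at_right)
    show "((\<lambda>x. t x * Y x) \<longlongrightarrow> 0) (at_left 1)" using tendsto_mult[OF t Y] by simp
    show "eventually (\<lambda>x. t x * Y x > 0) (at_left 1)"
      using ev by eventually_elim (simp add: t_def)
  qed
  hence "filterlim (\<lambda>x. inverse (t x * Y x)) at_top (at_left 1)"
    by (rule filterlim_compose[OF filterlim_inverse_at_top_right])
  moreover have "eventually (\<lambda>x. inverse (t x * Y x) = Y x / (1 - x)) (at_left 1)"
    using ev by eventually_elim (simp add: t_def field_simps power2_eq_square)
  ultimately have top: "filterlim (\<lambda>x. Y x / (1 - x)) at_top (at_left 1)"
    using filterlim_cong[OF refl refl] by fast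
  have "filterlim (\<lambda>x. S x * (Y x / (1 - x))) at_bot (at_left 1)"
    by (rule filterlim_tendsto_neg_mult_at_bot[OF S _ top]) (use \<delta> in simp)
  hence "filterlim (\<lambda>x. -2 + S x * (Y x / (1 - x))) at_bot (at_left 1)"
    unfolding filterlim_tendsto_add_at_bot_iff[OF tendsto_const] .
  moreover have "eventually (\<lambda>x. -2 + S x * (Y x / (1 - x)) = h x - (2 - \<delta>) / (1 - x)) (at_left 1)"
    using ev by eventually_elim (rule h[symmetric])
  ultimately show "filterlim (\<lambda>x. h x - (2 - \<delta>) / (1 - x)) at_bot (at_left 1)"
    using filterlim_cong[OF refl refl] by fast
qed

text \<open>A lower bound \<open>M\<close> makes \<open>q\<close> positive in real part. Harnack's
  inequality between \<open>x\<close> and \<open>r\<close>, with \<open>r\<close> tending to 1, then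
  bounds \<open>h x - L / (1 - x)\<close> below by \<open>M - 1 - L / 2\<close>, against the
  assumption \<open>bot\<close>.\<close>

lemma Re_convexity_unbounded:
  assumes lim: "((\<lambda>x. (1 - x) * h x) \<longlongrightarrow> L) (at_left 1)"
    and bot: "filterlim (\<lambda>x. h x - L / (1 - x)) at_bot (at_left 1)"
    and nz: "eventually (\<lambda>x. Y x + K x \<noteq> 0) (at_left 1)"
  defines "w \<equiv> hyp_ratio (of_real a) (of_real b) (of_real c)"
  shows "\<exists>z\<in>ball 0 1. Re (z * deriv (deriv w) z / deriv w z) < M"
proof (rule ccontr)
  assume "\<not> ?thesis"
  hence M: "Re (z * deriv (deriv w) z / deriv w z) \<ge> M" if "z \<in> ball 0 1" for z
    using that by (auto simp: not_less)
  \<comment> \<open>The shift by \<open>1 - M\<close> instead of \<open>-M\<close> makes the real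
    part strictly positive, also where a division by zero gives the default value 0.\<close>
  define q where "q z = z * deriv (deriv w) z / deriv w z + of_real (1 - M)" for z
  have q_pos: "Re (q z) > 0" if "z \<in> ball 0 1" for z
    using M[OF that] by (simp add: q_def)
  have mero: "q meromorphic_on ball 0 1"
    unfolding q_def w_def by (intro meromorphic_intros hyp_ratio_meromorphic a b c)
  have ana: "q analytic_on {of_real x}" and val: "q (of_real x) = of_real (h x + (1 - M))"
    if "0 < x \<and> x < 1" "Y x + K x \<noteq> 0" for x
    using convexity_expr_hyp_ratio_of_real[OF a b c, of x, folded w_def] that
    unfolding q_def by (auto intro!: analytic_intros)
  have bound: "h x - L / (1 - x) \<ge> M - 1 - L / 2" if x: "0 < x \<and> x < 1" "Y x + K x \<noteq> 0" for x
  proof -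
    have le: "(h r + (1 - M)) * (1 - r) * (1 + x) \<le> (h x + (1 - M)) * (1 - x) * (1 + r)"
      if "0 < r \<and> r < 1" "Y r + K r \<noteq> 0" "x < r" for r
      using that x by (intro Harnack_meromorphic[OF mero q_pos ana ana val val]) auto
    have "eventually (\<lambda>r. x < r) (at_left 1)"
      using x by (intro eventually_at_leftI[of x]) auto
    hence ev: "eventually (\<lambda>r. (h r + (1 - M)) * (1 - r) * (1 + x) \<le>
        (h x + (1 - M)) * (1 - x) * (1 + r)) (at_left 1)"
      using eventually_at_left_1 nz by eventually_elim (rule le)
    have "((\<lambda>r. ((1 - r) * h r + (1 - M) * (1 - r)) * (1 + x)) \<longlongrightarrow> (L + (1 - M) * (1 - 1)) * (1 + x)) (at_left 1)"
      by (intro tendsto_intros lim)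
    hence "((\<lambda>r. (h r + (1 - M)) * (1 - r) * (1 + x)) \<longlongrightarrow> L * (1 + x)) (at_left 1)"
      by (simp add: algebra_simps)
    moreover have "((\<lambda>r. (h x + (1 - M)) * (1 - x) * (1 + r)) \<longlongrightarrow> (h x + (1 - M)) * (1 - x) * (1 + 1)) (at_left 1)"
      by (intro tendsto_intros)
    ultimately have "L * (1 + x) \<le> (h x + (1 - M)) * (1 - x) * 2"
      using tendsto_le[OF _ _ _ ev] by simp
    hence "L * (1 + x) / (2 * (1 - x)) \<le> h x + (1 - M)"
      using x by (simp add: divide_le_eq) (simp add: algebra_simps)
    \<comment> \<open>The Harnack factor \<open>(1 + x) / (2 * (1 - x))\<close> differs from
      \<open>1 / (1 - x)\<close> only by the constant \<open>1 / 2\<close>, so no unbounded term is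
      lost.\<close>
    moreover have "L * (1 + x) / (2 * (1 - x)) = L / (1 - x) - L / 2"
      using x by (simp add: divide_simps) (simp add: algebra_simps)
    ultimately show ?thesis by simp
  qed
  have "eventually (\<lambda>x. h x - L / (1 - x) < M - 1 - L / 2) (at_left 1)"
    using bot by (auto simp: filterlim_at_bot_dense)
  hence "eventually (\<lambda>x. False) (at_left (1 :: real))"
    using eventually_at_left_1 nz by eventually_elim (use bound in fastforce)
  thus False by simp
qed

end

section \<open>Conclusion for the order of convexity\<close>

lemma order_of_convexity_eq_MInfty:
  assumes "\<And>M. \<exists>z\<in>ball 0 1. Re (z * deriv (deriv f) z / deriv f z) < M"
  shows "order_of_convexity f = -\<infinity>"
proof -
  have "(INF z \<in> ball 0 1. ereal (Re (z * deriv (deriv f) z / deriv f z))) = -\<infinity>"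
  proof (rule ereal_bot)
    fix M
    obtain z where "z \<in> ball 0 1" "Re (z * deriv (deriv f) z / deriv f z) < M"
      using assms by blast
    thus "(INF z \<in> ball 0 1. ereal (Re (z * deriv (deriv f) z / deriv f z))) \<le> ereal M"
      by (intro INF_lower2) auto
  qed
  thus ?thesis by (simp add: order_of_convexity_def)
qed

theorem theorem1p1:
  fixes a b c :: real
  assumes "a > 0" and "b > 0" and "c > 0"
    and "a + b - 1 < c" and "c < a + b + 1 / 2"
    and "(c - a) * (c - b) > 0"
  shows "kappa (complex_of_real a) (complex_of_real b) (complex_of_real c) = -\<infinity> \<and>
         \<not> convex_on_disc (hyp_ratio (complex_of_real a) (complex_of_real b) (complex_of_real c))"
proof -
  let ?w = "hyp_ratio (complex_of_real a) (complex_of_real b) (complex_of_real c)"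
  have "\<exists>z\<in>ball 0 1. Re (z * deriv (deriv ?w) z / deriv ?w z) < M" for M
  \<comment> \<open>The sign decides the limit of \<open>Y\<close> at 1, and with it
    \<open>L\<close>: \<open>L = 2\<close> for negative \<open>c - a - b\<close>, and
    \<open>L = 2 - (c - a - b)\<close> otherwise.\<close>
  proof (cases "c - a - b < 0")
    case True
    thus ?thesis
      using assms by (intro Re_convexity_unbounded[OF _ _ _ convexity_expr_asymp_neg]) auto
  next
    case False
    thus ?thesis
      using assms by (intro Re_convexity_unbounded[OF _ _ _ convexity_expr_asymp_nonneg]) auto
  qed
  hence "order_of_convexity ?w = -\<infinity>" by (rule order_of_convexity_eq_MInfty)
  thus ?thesis by (simp add: kappa_def convex_on_disc_def)
qed

end
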